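(* (i) For $l=4$, the full linkage system $\mathscr{L}(D_4)$ (resp. $\mathscr{L}(D_4(a_1))$) consists only of its $D$-component. Each of these $D$-components consists of three orbits of size $8$ each. (ii) For $l>7$ and any $1\le k\le\lfloor\frac{l-2}{2}\rfloor$, the full linkage system $\mathscr{L}(D_l)$ (resp. $\mathscr{L}(D_l(a_k))$) consists only of its $D$-component. Each of these $D$-components consists of one orbit of size $2l$. (iii) For $l=5$, the full linkage system $\mathscr{L}(D_5)$ (resp. $\mathscr{L}(D_5(a_1))$) consists of the $D$-component ($10$ elements) and the $E$-component consisting of two orbits ($2\times16$ elements). In total, $\mathscr{L}(D_5)$ contains $42$ elements. (iv) For $l=6$, the full linkage system $\mathscr{L}(D_6)$ (resp. $\mathscr{L}(D_6(a_1))$, resp. $\mathscr{L}(D_6(a_2))$) consists of the $D$-component ($12$ elements) and the $E$-component consisting of two orbits ($2\times32$ elements). In total, $\mathscr{L}(D_6)$ contains $76$ elements. (v) For $l=7$, the full linkage system $\mathscr{L}(D_7)$ (resp. $\mathscr{L}(D_7(a_1))$, resp. $\mathscr{L}(D_7(a_2))$) consists of the $D$-component ($14$ elements) and the $E$-component consisting of two orbits ($2\times64$ elements). In total, $\mathscr{L}(D_7)$ contains $142$ elements. Here orbits are orbits of the Weyl group $W_S^{\vee}$ of the quadratic form $\mathscr{B}^{\vee}$ of the corresponding diagram.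
   Context: All root systems are simply-laced, with inner product normalized so that $(\alpha,\alpha)=2$ for every root. A Carter diagram $\Gamma'$ is a graph with solid and dotted edges whose nodes correspond to linearly independent roots $\tau_1,\dots,\tau_l$ of such a root system, with $\tau_i,\tau_j$ joined by a solid edge iff $(\tau_i,\tau_j)=-1$, by a dotted edge iff $(\tau_i,\tau_j)=1$, not joined iff $(\tau_i,\tau_j)=0$, all cycles having an even number of nodes; such a (labelled) set of roots is called a $\Gamma'$-set. $D_l$ ($l\ge4$) is the usual Dynkin diagram with all edges solid. $D_l(a_k)$, $1\le k\le\lfloor\frac{l-2}{2}\rfloor$, is the Carter diagram on $l$ nodes consisting of a 4-cycle with three solid edges and one dotted edge, to two opposite nodes of which are attached simple chains (all edges solid) with $k-1$ and $l-k-3$ further nodes. For a connected simply-laced Dynkin diagram $\widetilde\Gamma$ of rank $l+1$ whose root system $\varPhi(\widetilde\Gamma)$ contains a $\Gamma'$-set, and a $\Gamma'$-set $S'=\{\tau_1,\dots,\tau_l\}\subset\varPhi(\widetilde\Gamma)$ with linear span $L(S')$, put $\mathscr{L}_{\widetilde\Gamma}(\Gamma',S')=\{\gamma^{\nabla}\mid\gamma\in\varPhi(\widetilde\Gamma),\ \gamma\notin L(S'),\ \gamma^\nabla\neq0\}$, where $\gamma^{\nabla}=((\gamma,\tau_1),\dots,(\gamma,\tau_l))^t$. The partial linkage system $\mathscr{L}_{\widetilde\Gamma}(\Gamma')$ is the union of the sets $\mathscr{L}_{\widetilde\Gamma}(\Gamma',S')$ over the $\Gamma'$-sets $S'\subset\varPhi(\widetilde\Gamma)$.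 The full linkage system is $\mathscr{L}(\Gamma')=\bigcup_{\widetilde\Gamma}\mathscr{L}_{\widetilde\Gamma}(\Gamma')$, the union over all such $\widetilde\Gamma$. For $\Gamma'=D_l$ or $D_l(a_k)$, the $D$-component of $\mathscr{L}(\Gamma')$ is $\mathscr{L}_{D_{l+1}}(\Gamma')$, and the $E$-component (for $l=5,6,7$) is the set of elements of $\mathscr{L}_{E_{l+1}}(\Gamma')$ not lying in the $D$-component. Let $B=((\tau_i,\tau_j))$ be the partial Cartan matrix of $\Gamma'$ (depending only on $\Gamma'$) and $\mathscr{B}^{\vee}(v)={}^tv\,B^{-1}v$. The group $W_S^{\vee}$ is generated by the dual reflections $s^*_{\tau_i}$, $i=1,\dots,l$, acting on column vectors $v$ by $s^*_{\tau_i}v=v-v_i\,(B e_i)$, where $e_i$ is the $i$-th standard basis vector and $v_i$ the $i$-th coordinate of $v$; it acts on $\mathscr{L}(\Gamma')$. *)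

theory Defs
  imports "HOL-Algebra.Group_Action" "HOL-Algebra.Generated_Groups"
    "Jordan_Normal_Form.VS_Connect"
begin

section \<open>Diagrams\<close>

text \<open>The nodes of a diagram are \<open>0, \<dots>, num_nodes - 1\<close>; an edge is a two-element set of nodes.
  A Dynkin diagram is the case without dotted edges.\<close>

record diagram =
  num_nodes :: nat
  solid :: "nat set set"
  dotted :: "nat set set"

definition path_edges :: "nat \<Rightarrow> nat set set" where
  "path_edges m = {{i, Suc i} | i. Suc i < m}"

definition A_diagram :: "nat \<Rightarrow> diagram" where
  "A_diagram n = \<lparr>num_nodes = n, solid = path_edges n, dotted = {}\<rparr>"

definition D_diagram :: "nat \<Rightarrow> diagram" where
  "D_diagram n = \<lparr>num_nodes = n,
     solid = insert {n - 3, n - 1} (path_edges (n - 1)), dotted = {}\<rparr>"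

text \<open>A path \<open>0 - \<dots> - (n - 2)\<close> with the node \<open>n - 1\<close> attached to the node \<open>2\<close>, so that the arms
  have lengths \<open>2\<close>, \<open>n - 4\<close> and \<open>1\<close>.\<close>

definition E_diagram :: "nat \<Rightarrow> diagram" where
  "E_diagram n = \<lparr>num_nodes = n,
     solid = insert {2, n - 1} (path_edges (n - 1)), dotted = {}\<rparr>"

definition connected_ADE :: "nat \<Rightarrow> diagram set" where
  "connected_ADE n = (if 1 \<le> n then {A_diagram n} else {}) \<union>
     (if 4 \<le> n then {D_diagram n} else {}) \<union> (if n \<in> {6, 7, 8} then {E_diagram n} else {})"

text \<open>The diagram \<open>D\<^sub>l(a\<^sub>k)\<close> is laid out as follows. The four-cycle is
  \<open>k - 1, k, k + 1, l - 1\<close>; its two opposite nodes \<open>k - 1\<close> and \<open>k + 1\<close> carry the chains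
  \<open>k - 2, \<dots>, 0\<close> (of \<open>k - 1\<close> nodes) and \<open>k + 2, \<dots>, l - 2\<close> (of \<open>l - k - 3\<close> nodes).
  The position \<open>e\<close> of the dotted edge on the cycle is a parameter.\<close>

definition Da_cycle :: "nat \<Rightarrow> nat \<Rightarrow> nat set set" where
  "Da_cycle l k = {{k - 1, k}, {k, k + 1}, {k - 1, l - 1}, {k + 1, l - 1}}"

definition Da_diagram :: "nat \<Rightarrow> nat \<Rightarrow> nat set \<Rightarrow> diagram" where
  "Da_diagram l k e = \<lparr>num_nodes = l,
     solid = (path_edges (l - 1) \<union> Da_cycle l k) - {e}, dotted = {e}\<rparr>"

text \<open>\<open>D\<^sub>l\<close> together with all \<open>D\<^sub>l(a\<^sub>k)\<close>.\<close>

definition D_family :: "nat \<Rightarrow> diagram set" where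
  "D_family l = insert (D_diagram l)
     {Da_diagram l k e | k e. 1 \<le> k \<and> k \<le> (l - 2) div 2 \<and> e \<in> Da_cycle l k}"


section \<open>Root systems\<close>

definition cartan :: "diagram \<Rightarrow> real mat" where
  "cartan G = mat (num_nodes G) (num_nodes G) (\<lambda>(i, j).
     if i = j then 2 else if {i, j} \<in> solid G then -1 else if {i, j} \<in> dotted G then 1 else 0)"

definition reflection_group :: "nat \<Rightarrow> (nat \<Rightarrow> real vec \<Rightarrow> real vec) \<Rightarrow> (real vec \<Rightarrow> real vec) monoid"
  where "reflection_group n s = (BijGroup (carrier_vec n))
    \<lparr>carrier := generate (BijGroup (carrier_vec n))
       ((\<lambda>i. restrict (s i) (carrier_vec n)) ` {..<n})\<rparr>"

text \<open>The root system of a Dynkin diagram lives in the coordinates with respect to the simple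
  roots: the \<open>i\<close>-th simple root is the \<open>i\<close>-th unit vector, and the inner product has the Cartan
  matrix as its Gram matrix. The roots are the images of the simple roots under the Weyl group.\<close>

definition inner_root :: "diagram \<Rightarrow> real vec \<Rightarrow> real vec \<Rightarrow> real" where
  "inner_root G x y = x \<bullet> (cartan G *\<^sub>v y)"

definition simple_reflection :: "diagram \<Rightarrow> nat \<Rightarrow> real vec \<Rightarrow> real vec" where
  "simple_reflection G i x =
     x - inner_root G x (unit_vec (num_nodes G) i) \<cdot>\<^sub>v unit_vec (num_nodes G) i"

definition roots :: "diagram \<Rightarrow> real vec set" where
  "roots G = (\<Union>i<num_nodes G. orbit (reflection_group (num_nodes G) (simple_reflection G))
     (\<lambda>g. g) (unit_vec (num_nodes G) i))"


section \<open>Linkage systems\<close>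

text \<open>\<open>gamma_set \<Gamma> G \<tau>\<close>: the family \<open>\<tau> 0, \<tau> 1, \<dots>\<close> (indexed by the nodes of \<open>\<Gamma>\<close>) is a
  \<open>\<Gamma>\<close>-set in the root system of \<open>G\<close>.\<close>

definition gamma_set :: "diagram \<Rightarrow> diagram \<Rightarrow> (nat \<Rightarrow> real vec) \<Rightarrow> bool" where
  "gamma_set \<Gamma> G \<tau> \<longleftrightarrow>
     (\<forall>i<num_nodes \<Gamma>. \<tau> i \<in> roots G) \<and>
     inj_on \<tau> {..<num_nodes \<Gamma>} \<and>
     LinearCombinations.module.lin_indpt class_ring (module_vec TYPE(real) (num_nodes G)) (\<tau> ` {..<num_nodes \<Gamma>}) \<and>
     (\<forall>i<num_nodes \<Gamma>. \<forall>j<num_nodes \<Gamma>. i \<noteq> j \<longrightarrow>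
        ({i, j} \<in> solid \<Gamma> \<longleftrightarrow> inner_root G (\<tau> i) (\<tau> j) = -1) \<and>
        ({i, j} \<in> dotted \<Gamma> \<longleftrightarrow> inner_root G (\<tau> i) (\<tau> j) = 1) \<and>
        ({i, j} \<notin> solid \<Gamma> \<union> dotted \<Gamma> \<longleftrightarrow> inner_root G (\<tau> i) (\<tau> j) = 0))"

definition linkage_labels ::
    "diagram \<Rightarrow> diagram \<Rightarrow> (nat \<Rightarrow> real vec) \<Rightarrow> real vec \<Rightarrow> real vec" where
  "linkage_labels \<Gamma> G \<tau> \<gamma> = vec (num_nodes \<Gamma>) (\<lambda>i. inner_root G \<gamma> (\<tau> i))"

definition linkages_of_set ::
    "diagram \<Rightarrow> diagram \<Rightarrow> (nat \<Rightarrow> real vec) \<Rightarrow> real vec set" where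
  "linkages_of_set \<Gamma> G \<tau> = {linkage_labels \<Gamma> G \<tau> \<gamma> | \<gamma>. \<gamma> \<in> roots G \<and>
     \<gamma> \<notin> LinearCombinations.module.span class_ring (module_vec TYPE(real) (num_nodes G)) (\<tau> ` {..<num_nodes \<Gamma>}) \<and>
     linkage_labels \<Gamma> G \<tau> \<gamma> \<noteq> 0\<^sub>v (num_nodes \<Gamma>)}"

definition partial_linkage :: "diagram \<Rightarrow> diagram \<Rightarrow> real vec set" where
  "partial_linkage G \<Gamma> = (\<Union>\<tau> \<in> {\<tau>. gamma_set \<Gamma> G \<tau>}. linkages_of_set \<Gamma> G \<tau>)"

definition full_linkage :: "diagram \<Rightarrow> real vec set" where
  "full_linkage \<Gamma> =
     (\<Union>G \<in> {G \<in> connected_ADE (num_nodes \<Gamma> + 1). \<exists>\<tau>. gamma_set \<Gamma> G \<tau>}. partial_linkage G \<Gamma>)"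

definition D_component :: "diagram \<Rightarrow> real vec set" where
  "D_component \<Gamma> = partial_linkage (D_diagram (num_nodes \<Gamma> + 1)) \<Gamma>"

text \<open>Only meaningful when \<open>num_nodes \<Gamma> + 1\<close> is 6, 7 or 8.\<close>

definition E_component :: "diagram \<Rightarrow> real vec set" where
  "E_component \<Gamma> = partial_linkage (E_diagram (num_nodes \<Gamma> + 1)) \<Gamma> - D_component \<Gamma>"


section \<open>The dual Weyl group and its orbits\<close>

definition dual_reflection :: "diagram \<Rightarrow> nat \<Rightarrow> real vec \<Rightarrow> real vec" where
  "dual_reflection \<Gamma> i v = v - v $ i \<cdot>\<^sub>v (cartan \<Gamma> *\<^sub>v unit_vec (num_nodes \<Gamma>) i)"

definition dual_weyl_group :: "diagram \<Rightarrow> (real vec \<Rightarrow> real vec) monoid" where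
  "dual_weyl_group \<Gamma> = reflection_group (num_nodes \<Gamma>) (dual_reflection \<Gamma>)"

text \<open>\<open>X\<close> is the union of exactly \<open>m\<close> orbits, each of size \<open>s\<close>; in particular \<open>X\<close> is invariant,
  since the orbits of its elements are taken in the whole space.\<close>

definition consists_of_orbits :: "diagram \<Rightarrow> real vec set \<Rightarrow> nat \<Rightarrow> nat \<Rightarrow> bool" where
  "consists_of_orbits \<Gamma> X m s \<longleftrightarrow>
     \<Union> (orbits (dual_weyl_group \<Gamma>) X (\<lambda>g. g)) = X \<and>
     card (orbits (dual_weyl_group \<Gamma>) X (\<lambda>g. g)) = m \<and>
     (\<forall>\<Omega> \<in> orbits (dual_weyl_group \<Gamma>) X (\<lambda>g. g). card \<Omega> = s)"

end

theory Submission
  imports Defs "HOL-Combinatorics.Permutations"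
begin

text \<open>All the diagrams of \<^const>\<open>D_family\<close> are Gram matrices of bases of the lattice \<open>D\<^sub>l\<close>
  made of signed roots \<open>\<plusminus>(e\<^sub>i - e\<^sub>i\<^sub>+\<^sub>1)\<close> together with \<open>\<plusminus>(e\<^sub>k + e\<^sub>k\<^sub>+\<^sub>1)\<close>. A
  \<open>\<Gamma>\<close>-set therefore determines an orthonormal frame \<open>x\<^sub>j\<close> of its span, and the labels of a root
  \<open>\<gamma>\<close> are read off its coordinates \<open>c\<^sub>j = (\<gamma>, x\<^sub>j)\<close>. These are all integral or all half-odd, and
  by Bessel's inequality \<open>\<Sum> c\<^sub>j\<^sup>2 < 2\<close> if \<open>\<gamma>\<close> lies outside the span; so they form either
  some \<open>\<plusminus>e\<^sub>i\<close> or, for \<open>l \<le> 7\<close> only, a vector \<open>(\<plusminus>1/2, \<dots>, \<plusminus>1/2)\<close>. Conversely, frames can be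
  permuted and have their signs changed freely, so one root of each shape yields all of them:
  the extra simple root of \<open>D\<^sub>l\<^sub>+\<^sub>1\<close> gives \<open>e\<^sub>i\<close>, and that of \<open>E\<^sub>l\<^sub>+\<^sub>1\<close> a half-spin vector, where
  \<open>E\<^sub>5 = D\<^sub>5\<close> is triality. In these coordinates the dual Weyl group acts by permutations and even
  sign changes.\<close>

section \<open>Orbits of groups generated by involutions\<close>

text \<open>No classification of \<Gamma>-sets is made. The upper bound on linkages holds for every
  \<Gamma>-set in every positive definite ambient diagram, so type A needs no separate discussion;
  the lower bound needs one explicit frame in \<open>D_diagram (Suc l)\<close> or
  \<open>E_diagram (Suc l)\<close>. Shortness alone does not keep half-spin vectors out of the
  D-component for l = 5, 6, 7. There the ambient space R^(l+1) has standard coordinates in which all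
  roots of D_(l+1) are integral. In each such coordinate a the frame vectors are all integral or all
  half-odd; the second case would give e_a a projection onto their span of squared length at least
  l/4 > 1. So the frame is integral, and so are the coordinates of \<gamma>. At l = 4 the bound is 1
  and triality survives. Both half-spin parities occur because a frame may have any signs changed,
  while the dual Weyl group changes them in pairs; this is why there are two orbits. One closure
  argument serves twice: stability under the basis reflections implies stability under all
  permutations and paired sign changes. Applied to invariant label sets it gives the orbits; applied
  to roots it shows that all +-x_i +-x_j are roots.\<close>

lemma orbit_refl:
  assumes "x \<in> carrier_vec n"
  shows "x \<in> orbit (reflection_group n s) (\<lambda>g. g) x"
proof -
  have "\<one>\<^bsub>BijGroup (carrier_vec n)\<^esub> x = x" using assms by (simp add: BijGroup_def)
  then show ?thesis
    unfolding orbit_def reflection_group_def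
    by (auto intro!: exI[of _ "\<one>\<^bsub>BijGroup (carrier_vec n)\<^esub>"] generate.one)
qed

text \<open>Generators that are their own inverses: the inverse case of \<open>generate\<close>
  collapses to the generator case, so orbits can be explored by applying the \<open>s i\<close>
  alone. The instances are the simple reflections and the dual reflections.\<close>

locale involutions =
  fixes n :: nat and s :: "nat \<Rightarrow> real vec \<Rightarrow> real vec"
  assumes closed: "i < n \<Longrightarrow> x \<in> carrier_vec n \<Longrightarrow> s i x \<in> carrier_vec n"
    and involutive: "i < n \<Longrightarrow> x \<in> carrier_vec n \<Longrightarrow> s i (s i x) = x"
begin

abbreviation "C \<equiv> (carrier_vec n :: real vec set)"
abbreviation "gen \<equiv> (\<lambda>i. restrict (s i) C) ` {..<n}"

lemma generator_Bij:
  assumes "i < n"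
  shows "restrict (s i) C \<in> Bij C"
  unfolding Bij_def
  by (auto intro!: bij_betw_byWitness[of _ "s i"] simp: closed involutive assms)

lemma generate_Bij: "g \<in> generate (BijGroup C) gen \<Longrightarrow> g \<in> Bij C"
  using group.generate_in_carrier[OF group_BijGroup, of gen C g] generator_Bij
  by (auto simp: BijGroup_def)

lemma mult_apply:
  "g \<in> Bij C \<Longrightarrow> h \<in> Bij C \<Longrightarrow> x \<in> C \<Longrightarrow> (g \<otimes>\<^bsub>BijGroup C\<^esub> h) x = g (h x)"
  by (simp add: BijGroup_def compose_def)

lemma inv_generator:
  assumes i: "i < n"
  shows "inv\<^bsub>BijGroup C\<^esub> (restrict (s i) C) = restrict (s i) C"
proof (rule group.inv_equality[OF group_BijGroup])
  show "restrict (s i) C \<otimes>\<^bsub>BijGroup C\<^esub> restrict (s i) C = \<one>\<^bsub>BijGroup C\<^esub>"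
    using generator_Bij[OF i]
    by (auto simp: BijGroup_def compose_def closed involutive i fun_eq_iff)
qed (use generator_Bij[OF i] in \<open>auto simp: BijGroup_def\<close>)

lemma orbit_step:
  assumes "y \<in> orbit (reflection_group n s) (\<lambda>g. g) x" "x \<in> C" "i < n"
  shows "s i y \<in> orbit (reflection_group n s) (\<lambda>g. g) x"
proof -
  obtain g where g: "g \<in> generate (BijGroup C) gen" "y = g x"
    using assms unfolding orbit_def reflection_group_def by auto
  have gx: "g x \<in> C"
    using Bij_imp_funcset[OF generate_Bij[OF g(1)]] assms by auto
  have "(restrict (s i) C \<otimes>\<^bsub>BijGroup C\<^esub> g) x = s i y"
    using mult_apply[OF generator_Bij generate_Bij] assms g gx by simp
  moreover have "restrict (s i) C \<otimes>\<^bsub>BijGroup C\<^esub> g \<in> generate (BijGroup C) gen"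
    by (rule generate.eng[OF generate.incl g(1)]) (use assms(3) in auto)
  ultimately show ?thesis
    unfolding orbit_def reflection_group_def
    by (intro CollectI exI[of _ "restrict (s i) C \<otimes>\<^bsub>BijGroup C\<^esub> g"]) simp
qed

text \<open>With \<open>orbit_refl\<close> and \<open>orbit_step\<close> this identifies the orbit
  as the least set containing \<open>x\<close> and stable under every \<open>s i\<close>; later
  arguments work with this description instead of group elements.\<close>

lemma orbit_induct:
  assumes "y \<in> orbit (reflection_group n s) (\<lambda>g. g) x" "x \<in> C" "P x"
    and step: "\<And>i z. i < n \<Longrightarrow> z \<in> C \<Longrightarrow> P z \<Longrightarrow> P (s i z)"
  shows "P y"
proof -
  obtain g where g: "g \<in> generate (BijGroup C) gen" "y = g x"
    using assms unfolding orbit_def reflection_group_def by auto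
  \<comment> \<open>Quantified over all points, because in a product the first factor acts on a
    point already moved by the second.\<close>
  have "\<forall>z\<in>C. P z \<longrightarrow> P (g z)"
    using g(1)
  proof induction
    case one
    then show ?case by (simp add: BijGroup_def)
  next
    case (incl h)
    then show ?case using step by auto
  next
    case (inv h)
    then show ?case using step inv_generator by auto
  next
    case (eng h1 h2)
    have "h2 z \<in> C" if "z \<in> C" for z
      using Bij_imp_funcset[OF generate_Bij[OF eng(2)]] that by auto
    then show ?case
      using eng by (auto simp: mult_apply[OF generate_Bij generate_Bij])
  qed
  then show ?thesis using assms g by simp
qed

lemma orbit_carrier:
  assumes "y \<in> orbit (reflection_group n s) (\<lambda>g. g) x" "x \<in> C"
  shows "y \<in> C"
  by (rule orbit_induct[OF assms]) (use assms closed in auto)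

end


section \<open>Linear combinations of finite families\<close>

text \<open>Coefficients are attached to indices, not to vectors as in \<open>lincomb\<close>, so
  that re-expanding one family in another is a matrix product on coefficients
  (\<open>comb_comb\<close>). Translating to spans of sets costs an injectivity assumption.\<close>

definition comb :: "nat \<Rightarrow> nat \<Rightarrow> (nat \<Rightarrow> real) \<Rightarrow> (nat \<Rightarrow> real vec) \<Rightarrow> real vec" where
  "comb n m a \<tau> = vec n (\<lambda>r. \<Sum>p<m. a p * \<tau> p $ r)"

lemma comb_carrier [simp]: "comb n m a \<tau> \<in> carrier_vec n"
  by (simp add: comb_def)

lemma comb_comb:
  "comb n m a (\<lambda>p. comb n l (b p) x) = comb n l (\<lambda>j. \<Sum>p<m. a p * b p j) x"
  unfolding comb_def
  by (auto simp: sum_distrib_left sum_distrib_right mult.assoc intro!: eq_vecI sum.swap)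

lemma lincomb_family:
  assumes "inj_on \<tau> {..<m}" "\<And>p. p < m \<Longrightarrow> \<tau> p \<in> carrier_vec n"
  shows "LinearCombinations.module.lincomb (module_vec TYPE(real) n) b (\<tau> ` {..<m}) =
    comb n m (\<lambda>p. b (\<tau> p)) \<tau>"
proof -
  interpret vec_space "TYPE(real)" n .
  have sub: "\<tau> ` {..<m} \<subseteq> carrier_vec n" using assms by auto
  show ?thesis
  proof (rule eq_vecI)
    fix r assume "r < dim_vec (comb n m (\<lambda>p. b (\<tau> p)) \<tau>)"
    then have r: "r < n" by (simp add: comb_def)
    show "lincomb b (\<tau> ` {..<m}) $ r = comb n m (\<lambda>p. b (\<tau> p)) \<tau> $ r"
      using r assms by (simp add: lincomb_index[OF r sub] comb_def sum.reindex)
  qed (use lincomb_dim[OF _ sub, of b] in \<open>auto simp: comb_def\<close>)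
qed

lemma span_family:
  assumes "inj_on \<tau> {..<m}" "\<And>p. p < m \<Longrightarrow> \<tau> p \<in> carrier_vec n"
  shows "LinearCombinations.module.span class_ring (module_vec TYPE(real) n) (\<tau> ` {..<m}) =
    range (\<lambda>a. comb n m a \<tau>)"
proof -
  interpret vec_space "TYPE(real)" n .
  have "span (\<tau> ` {..<m}) = {lincomb b (\<tau> ` {..<m}) | b. b \<in> \<tau> ` {..<m} \<rightarrow> UNIV}"
    by (subst finite_span) (use assms in auto)
  also have "\<dots> = (\<lambda>b. comb n m (\<lambda>p. b (\<tau> p)) \<tau>) ` UNIV"
    using lincomb_family[OF assms] by auto
  also have "\<dots> = range (\<lambda>a. comb n m a \<tau>)"
  proof (intro equalityI subsetI)
    fix v assume "v \<in> range (\<lambda>a. comb n m a \<tau>)"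
    then obtain a where a: "v = comb n m a \<tau>" by auto
    have "v = comb n m (\<lambda>p. (a \<circ> the_inv_into {..<m} \<tau>) (\<tau> p)) \<tau>"
      using assms(1) by (auto simp: a comb_def the_inv_into_f_f intro!: eq_vecI sum.cong)
    then show "v \<in> (\<lambda>b. comb n m (\<lambda>p. b (\<tau> p)) \<tau>) ` UNIV" by blast
  qed auto
  finally show ?thesis .
qed

lemma lin_indpt_family:
  assumes "inj_on \<tau> {..<m}" "\<And>p. p < m \<Longrightarrow> \<tau> p \<in> carrier_vec n"
    and "\<And>a p. comb n m a \<tau> = 0\<^sub>v n \<Longrightarrow> p < m \<Longrightarrow> a p = 0"
  shows "LinearCombinations.module.lin_indpt class_ring (module_vec TYPE(real) n) (\<tau> ` {..<m})"
proof -
  interpret vec_space "TYPE(real)" n .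
  show ?thesis
  proof (rule finite_lin_indpt2)
    fix b assume "lincomb b (\<tau> ` {..<m}) = 0\<^sub>v n"
    then have "comb n m (\<lambda>p. b (\<tau> p)) \<tau> = 0\<^sub>v n"
      using lincomb_family[OF assms(1,2)] by simp
    then show "\<forall>v\<in>\<tau> ` {..<m}. b v = 0" using assms(3) by auto
  qed (use assms in auto)
qed


section \<open>Roots\<close>

lemma inner_root_sum:
  assumes "x \<in> carrier_vec (num_nodes G)" "y \<in> carrier_vec (num_nodes G)"
  shows "inner_root G x y =
    (\<Sum>i<num_nodes G. \<Sum>j<num_nodes G. x $ i * cartan G $$ (i, j) * y $ j)"
  using assms
  by (auto simp: inner_root_def scalar_prod_def cartan_def lessThan_atLeast0 sum_distrib_left
      intro!: sum.cong)

lemma cartan_sym: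
  "i < num_nodes G \<Longrightarrow> j < num_nodes G \<Longrightarrow> cartan G $$ (i, j) = cartan G $$ (j, i)"
  by (auto simp: cartan_def insert_commute)

lemma inner_root_sym:
  assumes "x \<in> carrier_vec (num_nodes G)" "y \<in> carrier_vec (num_nodes G)"
  shows "inner_root G x y = inner_root G y x"
  unfolding inner_root_sum[OF assms] inner_root_sum[OF assms(2,1)]
  by (subst sum.swap) (auto intro!: sum.cong simp: cartan_sym)

lemma inner_root_comb:
  assumes "y \<in> carrier_vec (num_nodes G)" "\<And>p. p < m \<Longrightarrow> \<tau> p \<in> carrier_vec (num_nodes G)"
  shows "inner_root G (comb (num_nodes G) m a \<tau>) y = (\<Sum>p<m. a p * inner_root G (\<tau> p) y)"
proof -
  let ?n = "num_nodes G"
  have "inner_root G (comb ?n m a \<tau>) y =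
      (\<Sum>i<?n. \<Sum>j<?n. \<Sum>p<m. a p * (\<tau> p $ i * cartan G $$ (i, j) * y $ j))"
    using assms by (simp add: inner_root_sum) (simp add: comb_def sum_distrib_right mult.assoc)
  also have "\<dots> = (\<Sum>i<?n. \<Sum>p<m. \<Sum>j<?n. a p * (\<tau> p $ i * cartan G $$ (i, j) * y $ j))"
    by (intro sum.cong refl sum.swap)
  also have "\<dots> = (\<Sum>p<m. \<Sum>i<?n. \<Sum>j<?n. a p * (\<tau> p $ i * cartan G $$ (i, j) * y $ j))"
    by (rule sum.swap)
  also have "\<dots> = (\<Sum>p<m. a p * inner_root G (\<tau> p) y)"
    using assms by (intro sum.cong refl) (simp add: inner_root_sum sum_distrib_left)
  finally show ?thesis .
qed

lemma inner_root_comb_right: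
  assumes "y \<in> carrier_vec (num_nodes G)" "\<And>p. p < m \<Longrightarrow> \<tau> p \<in> carrier_vec (num_nodes G)"
  shows "inner_root G y (comb (num_nodes G) m a \<tau>) = (\<Sum>p<m. a p * inner_root G y (\<tau> p))"
  using assms by (simp add: inner_root_sym[of y] inner_root_comb)

lemma inner_root_add_smult:
  assumes "x \<in> carrier_vec (num_nodes G)" "y \<in> carrier_vec (num_nodes G)"
    "z \<in> carrier_vec (num_nodes G)"
  shows "inner_root G (a \<cdot>\<^sub>v x + b \<cdot>\<^sub>v y) z = a * inner_root G x z + b * inner_root G y z"
    and "inner_root G z (a \<cdot>\<^sub>v x + b \<cdot>\<^sub>v y) = a * inner_root G z x + b * inner_root G z y"
    and "inner_root G (x - a \<cdot>\<^sub>v y) z = inner_root G x z - a * inner_root G y z"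
    and "inner_root G z (x - a \<cdot>\<^sub>v y) = inner_root G z x - a * inner_root G z y"
  using assms
  by (simp_all add: inner_root_sum) (simp_all add: sum_distrib_left sum.distrib sum_subtractf
      algebra_simps)

lemma inner_root_unit:
  assumes "i < num_nodes G" "j < num_nodes G"
  shows "inner_root G (unit_vec (num_nodes G) i) (unit_vec (num_nodes G) j) = cartan G $$ (i, j)"
proof -
  let ?n = "num_nodes G"
  have "inner_root G (unit_vec ?n i) (unit_vec ?n j) =
     (\<Sum>r<?n. \<Sum>t<?n. if t = j then (if r = i then cartan G $$ (r, t) else 0) else 0)"
    unfolding inner_root_sum[OF unit_vec_carrier unit_vec_carrier]
    using assms by (intro sum.cong refl) auto
  also have "\<dots> = cartan G $$ (i, j)"
    using assms by (simp add: sum.delta)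
  finally show ?thesis .
qed

lemma cartan_diag: "i < num_nodes G \<Longrightarrow> cartan G $$ (i, i) = 2"
  by (simp add: cartan_def)

lemma cartan_Ints: "i < num_nodes G \<Longrightarrow> j < num_nodes G \<Longrightarrow> cartan G $$ (i, j) \<in> \<int>"
  by (simp add: cartan_def)

lemma involutions_simple_reflection: "involutions (num_nodes G) (simple_reflection G)"
proof
  fix i and x :: "real vec"
  let ?n = "num_nodes G" let ?u = "unit_vec (num_nodes G) i :: real vec"
  assume i: "i < ?n" and x: "x \<in> carrier_vec ?n"
  show "simple_reflection G i x \<in> carrier_vec ?n"
    using x by (simp add: simple_reflection_def)
  have "inner_root G (x - inner_root G x ?u \<cdot>\<^sub>v ?u) ?u = - inner_root G x ?u"
    using x i by (simp add: inner_root_add_smult inner_root_unit cartan_diag)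
  then show "simple_reflection G i (simple_reflection G i x) = x"
    using x by (simp add: simple_reflection_def) (intro eq_vecI, auto)
qed

lemma roots_unit: "i < num_nodes G \<Longrightarrow> unit_vec (num_nodes G) i \<in> roots G"
  unfolding roots_def by (auto intro!: bexI[of _ i] orbit_refl)

lemma roots_reflection:
  assumes "x \<in> roots G" "i < num_nodes G"
  shows "simple_reflection G i x \<in> roots G"
  using assms unfolding roots_def
  by (auto intro!: involutions.orbit_step[OF involutions_simple_reflection])

lemma roots_induct [consumes 1, case_names unit reflection]:
  assumes "x \<in> roots G"
    and "\<And>i. i < num_nodes G \<Longrightarrow> P (unit_vec (num_nodes G) i)"
    and "\<And>i x. i < num_nodes G \<Longrightarrow> x \<in> carrier_vec (num_nodes G) \<Longrightarrow> P x \<Longrightarrow> P (simple_reflection G i x)"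
  shows "P x"
  using assms unfolding roots_def
  by (auto intro: involutions.orbit_induct[OF involutions_simple_reflection, where P = P])

lemma roots_carrier: "x \<in> roots G \<Longrightarrow> x \<in> carrier_vec (num_nodes G)"
  unfolding roots_def
  by (auto dest: involutions.orbit_carrier[OF involutions_simple_reflection])

lemma roots_norm: "x \<in> roots G \<Longrightarrow> inner_root G x x = 2"
proof (induction rule: roots_induct)
  case (unit i)
  then show ?case by (simp add: inner_root_unit cartan_diag)
next
  case (reflection i x)
  then show ?case
    by (simp add: simple_reflection_def inner_root_add_smult inner_root_unit cartan_diag
        inner_root_sym[of "unit_vec (num_nodes G) i" G x])
qed

lemma roots_Ints:
  assumes "x \<in> roots G" "j < num_nodes G"
  shows "x $ j \<in> \<int>"
proof -
  let ?n = "num_nodes G"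
  have "\<forall>j<?n. x $ j \<in> \<int>"
    using assms(1)
  proof (induction rule: roots_induct)
    case (unit i)
    then show ?case by simp
  next
    case (reflection i x)
    have "inner_root G x (unit_vec ?n i) \<in> \<int>"
      using reflection by (auto simp: inner_root_sum cartan_Ints intro!: Ints_mult Ints_sum)
    then show ?case using reflection by (auto simp: simple_reflection_def)
  qed
  then show ?thesis using assms by simp
qed

lemma roots_inner_Ints: "x \<in> roots G \<Longrightarrow> y \<in> roots G \<Longrightarrow> inner_root G x y \<in> \<int>"
  by (auto simp: inner_root_sum roots_carrier roots_Ints cartan_Ints intro!: Ints_mult Ints_sum)

section \<open>Signed bases of the lattice $D_l$\<close>

definition D_basis :: "nat \<Rightarrow> nat \<Rightarrow> (nat \<Rightarrow> real) \<Rightarrow> nat \<Rightarrow> nat \<Rightarrow> real" where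
  "D_basis l k \<epsilon> p j = \<epsilon> p * (if p = l - 1 then of_bool (j = k) + of_bool (j = Suc k)
     else of_bool (j = p) - of_bool (j = Suc p))"

text \<open>The coordinates \<open>u\<close> of a vector with given inner products with the \<open>D_basis\<close> vectors are
  obtained by summing the differences \<open>u\<^sub>p - u\<^sub>p\<^sub>+\<^sub>1\<close>; the constant is fixed by \<open>u\<^sub>k + u\<^sub>k\<^sub>+\<^sub>1\<close>.\<close>

definition D_dual :: "nat \<Rightarrow> nat \<Rightarrow> (nat \<Rightarrow> real) \<Rightarrow> nat \<Rightarrow> nat \<Rightarrow> real" where
  "D_dual l k \<epsilon> p j = \<epsilon> p * ((of_bool (p < k) + of_bool (p < Suc k) + of_bool (p = l - 1)) / 2 - of_bool (p < j))"

locale D_coords =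
  fixes l k :: nat and \<epsilon> :: "nat \<Rightarrow> real"
  assumes k_less: "Suc k < l" and sign: "\<epsilon> p = 1 \<or> \<epsilon> p = -1"
begin

abbreviation "D \<equiv> D_basis l k \<epsilon>"
abbreviation "N \<equiv> D_dual l k \<epsilon>"

text \<open>The passage from the frame coordinates of a vector to its inner products with the basis
  \<open>D\<close>. It is injective on coordinates below \<open>l\<close> (\<open>lab_inj\<close>),
  so statements about label vectors become statements about \<open>c\<close>.\<close>

definition lab :: "(nat \<Rightarrow> real) \<Rightarrow> real vec" where
  "lab c = vec l (\<lambda>p. \<Sum>j<l. D p j * c j)"

lemma lab_carrier [simp]: "lab c \<in> carrier_vec l"
  by (simp add: lab_def)

lemma sign_square: "\<epsilon> p * \<epsilon> p = 1"
  using sign[of p] by auto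

lemma sum_D_basis:
  assumes "p < l"
  shows "(\<Sum>j<l. D p j * f j) = \<epsilon> p * (if p = l - 1 then f k + f (Suc k) else f p - f (Suc p))"
proof -
  have delta: "(\<Sum>j<l. of_bool (j = a) * f j) = f a" if "a < l" for a
  proof -
    have "(\<Sum>j<l. of_bool (j = a) * f j) = (\<Sum>j<l. if j = a then f j else 0)"
      by (intro sum.cong) auto
    then show ?thesis using that by simp
  qed
  show ?thesis
  proof (cases "p = l - 1")
    case True
    have "(\<Sum>j<l. D p j * f j) =
        (\<Sum>j<l. \<epsilon> p * (of_bool (j = k) * f j + of_bool (j = Suc k) * f j))"
      using True by (intro sum.cong refl) (simp only: D_basis_def if_True simp_thms algebra_simps)
    also have "\<dots> = \<epsilon> p * (f k + f (Suc k))"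
      using k_less by (simp only: sum_distrib_left[symmetric] sum.distrib delta Suc_lessD)
    finally show ?thesis using True by simp
  next
    case False
    have "(\<Sum>j<l. D p j * f j) =
        (\<Sum>j<l. \<epsilon> p * (of_bool (j = p) * f j - of_bool (j = Suc p) * f j))"
      using False by (intro sum.cong refl) (simp only: D_basis_def if_False algebra_simps)
    also have "\<dots> = \<epsilon> p * (f p - f (Suc p))"
    proof -
      have "Suc p < l" using False assms by simp
      then show ?thesis
        using assms by (simp only: sum_distrib_left[symmetric] sum_subtractf delta)
    qed
    finally show ?thesis using False by simp
  qed
qed

text \<open>Orthogonality to the differences makes \<open>u\<close> constant on the indices below
  \<open>l\<close>; orthogonality to +-(e_k + e_(k+1)) makes that constant 0.\<close>

lemma D_inj:
  assumes "\<And>p. p < l \<Longrightarrow> (\<Sum>j<l. D p j * u j) = 0" "j < l"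
  shows "u j = 0"
proof -
  have ne: "\<epsilon> p \<noteq> 0" for p using sign[of p] by auto
  have step: "u p = u (Suc p)" if "Suc p < l" for p
    using assms(1)[of p] that ne[of p] by (auto simp: sum_D_basis split: if_splits)
  have const: "i < l \<Longrightarrow> u i = u 0" for i
    by (induction i) (use step in auto)
  have "u k + u (Suc k) = 0"
    using assms(1)[of "l - 1"] k_less ne by (auto simp: sum_D_basis)
  then show ?thesis using const[of k] const[of "Suc k"] const[of j] k_less assms(2) by simp
qed

lemma D_dual_left:
  assumes "p < l" "q < l"
  shows "(\<Sum>j<l. D q j * N p j) = of_bool (p = q)"
  unfolding sum_D_basis[OF assms(2)]
  using assms k_less sign_square[of p]
  by (auto simp: D_dual_def algebra_simps less_Suc_eq)

text \<open>A one-sided inverse of a square matrix is two-sided. Here this comes from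
  \<open>D_inj\<close>: applying \<open>D\<close> to a column of the difference between this product
  and the identity gives 0 by \<open>D_dual_left\<close>.\<close>

lemma D_dual_right:
  assumes "i < l" "j < l"
  shows "(\<Sum>p<l. N p j * D p i) = of_bool (i = j)"
proof -
  have "(\<Sum>p<l. N p j * D p i) - of_bool (i = j) = 0"
  proof (rule D_inj[where u = "\<lambda>j. (\<Sum>p<l. N p j * D p i) - of_bool (i = j)", OF _ assms(2)])
    fix q assume q: "q < l"
    have "(\<Sum>j<l. D q j * (\<Sum>p<l. N p j * D p i)) = (\<Sum>p<l. (\<Sum>j<l. D q j * N p j) * D p i)"
      by (simp add: sum_distrib_left sum_distrib_right mult.assoc) (rule sum.swap)
    also have "\<dots> = (\<Sum>p<l. if p = q then D p i else 0)"
      using q by (intro sum.cong) (auto simp: D_dual_left)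
    also have "\<dots> = D q i" using q by simp
    also have "\<dots> = (\<Sum>j<l. if j = i then D q j else 0)" using assms by simp
    also have "\<dots> = (\<Sum>j<l. D q j * of_bool (i = j))" by (intro sum.cong) auto
    finally show "(\<Sum>j<l. D q j * ((\<Sum>p<l. N p j * D p i) - of_bool (i = j))) = 0"
      by (simp add: right_diff_distrib sum_subtractf)
  qed
  then show ?thesis by simp
qed

text \<open>The source of the integral/half-odd dichotomy: integer labels produce coordinates in
  (1/2)Z that agree modulo Z, that is, elements of the dual lattice of D_l.\<close>

lemma N_Ints: "2 * N p j \<in> \<int>" "N p i - N p j \<in> \<int>"
  using sign[of p] by (auto simp: D_dual_def)

lemma D_Ints: "D p j \<in> \<int>"
  using sign[of p] by (auto simp: D_basis_def)

lemma lab_inj: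
  assumes "lab c = lab d" "j < l"
  shows "c j = d j"
proof -
  have "(\<lambda>j. c j - d j) j = 0"
  proof (rule D_inj[OF _ assms(2)])
    fix p assume "p < l"
    then have "lab c $ p = lab d $ p" using assms by simp
    then show "(\<Sum>j<l. D p j * (c j - d j)) = 0"
      using \<open>p < l\<close> by (simp add: lab_def right_diff_distrib sum_subtractf)
  qed
  then show ?thesis by simp
qed

lemma lab_cong: "(\<And>j. j < l \<Longrightarrow> c j = d j) \<Longrightarrow> lab c = lab d"
  by (simp add: lab_def)

end


section \<open>Orthonormal frames\<close>

definition pos_def :: "diagram \<Rightarrow> bool" where
  "pos_def G \<longleftrightarrow> (\<forall>x\<in>carrier_vec (num_nodes G). x \<noteq> 0\<^sub>v (num_nodes G) \<longrightarrow> 0 < inner_root G x x)"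

definition orthonormal :: "diagram \<Rightarrow> nat \<Rightarrow> (nat \<Rightarrow> real vec) \<Rightarrow> bool" where
  "orthonormal G l x \<longleftrightarrow> (\<forall>i<l. x i \<in> carrier_vec (num_nodes G)) \<and>
     (\<forall>i<l. \<forall>j<l. inner_root G (x i) (x j) = of_bool (i = j))"

lemma orthonormal_inner_comb:
  assumes "orthonormal G l x" "i < l"
  shows "inner_root G (comb (num_nodes G) l c x) (x i) = c i"
proof -
  have "inner_root G (comb (num_nodes G) l c x) (x i) = (\<Sum>p<l. if p = i then c p else 0)"
    using assms by (subst inner_root_comb) (auto simp: orthonormal_def intro!: sum.cong)
  then show ?thesis using assms by simp
qed

lemma orthonormal_inner_comb_comb:
  assumes "orthonormal G l x"
  shows "inner_root G (comb (num_nodes G) l c x) (comb (num_nodes G) l d x) = (\<Sum>i<l. c i * d i)"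
  using assms orthonormal_inner_comb[OF assms, of _ c]
  by (subst inner_root_comb_right) (auto simp: orthonormal_def mult.commute)

text \<open>The residual of \<open>g\<close> after projection has squared norm (g,g) minus the sum
  of the c_j^2. If that is not positive, positive definiteness makes the residual vanish.\<close>

lemma bessel:
  assumes x: "orthonormal G l x" and g: "g \<in> carrier_vec (num_nodes G)"
    and c: "\<And>j. j < l \<Longrightarrow> c j = inner_root G g (x j)"
    and pd: "pos_def G"
  shows "g = comb (num_nodes G) l c x \<or> (\<Sum>j<l. c j ^ 2) < inner_root G g g"
proof (rule disjCI)
  let ?n = "num_nodes G" let ?y = "comb ?n l c x"
  assume nl: "\<not> (\<Sum>j<l. c j ^ 2) < inner_root G g g"
  have gy: "inner_root G g ?y = (\<Sum>j<l. c j ^ 2)"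
    using x g c by (subst inner_root_comb_right) (auto simp: orthonormal_def power2_eq_square)
  have yy: "inner_root G ?y ?y = (\<Sum>j<l. c j ^ 2)"
    using orthonormal_inner_comb_comb[OF x, of c c] by (simp add: power2_eq_square)
  \<comment> \<open>The scalar 1 only puts the difference into the shape of
    \<open>inner_root_add_smult\<close>.\<close>
  have "inner_root G (g - 1 \<cdot>\<^sub>v ?y) (g - 1 \<cdot>\<^sub>v ?y) = inner_root G g g - (\<Sum>j<l. c j ^ 2)"
    unfolding inner_root_add_smult(3)[OF g comb_carrier minus_carrier_vec[OF g smult_carrier_vec[THEN iffD2, OF comb_carrier]]]
      inner_root_add_smult(4)[OF g comb_carrier g] inner_root_add_smult(4)[OF g comb_carrier comb_carrier]
    using gy yy inner_root_sym[OF comb_carrier g] by simp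
  then have "\<not> 0 < inner_root G (g - 1 \<cdot>\<^sub>v ?y) (g - 1 \<cdot>\<^sub>v ?y)" using nl by simp
  then have "g - 1 \<cdot>\<^sub>v ?y = 0\<^sub>v ?n" using pd g unfolding pos_def_def by force
  then show "g = ?y" using g by (simp add: vec_eq_iff comb_def)
qed

context D_coords
begin

text \<open>In matrix form: the Gram matrix of \<tau> is D D^T and \<open>N\<close> is inverse to
  \<open>D\<close>, so the combinations of \<tau> with coefficients \<open>N\<close> have the
  identity as Gram matrix, and \<tau> is recovered from them through \<open>D\<close>.\<close>

lemma frame_of_basis:
  assumes \<tau>: "\<And>p. p < l \<Longrightarrow> \<tau> p \<in> carrier_vec (num_nodes G)"
    and gram: "\<And>p q. p < l \<Longrightarrow> q < l \<Longrightarrow> inner_root G (\<tau> p) (\<tau> q) = (\<Sum>j<l. D p j * D q j)"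
  defines "x \<equiv> \<lambda>j. comb (num_nodes G) l (\<lambda>p. N p j) \<tau>"
  shows "orthonormal G l x"
    and "\<And>q. q < l \<Longrightarrow> \<tau> q = comb (num_nodes G) l (D q) x"
    and "\<And>c. comb (num_nodes G) l c x = comb (num_nodes G) l (\<lambda>p. \<Sum>j<l. c j * N p j) \<tau>"
proof -
  let ?n = "num_nodes G"
  show combx: "comb ?n l c x = comb ?n l (\<lambda>p. \<Sum>j<l. c j * N p j) \<tau>" for c
    unfolding x_def by (rule comb_comb)
  have xt: "inner_root G (x i) (\<tau> q) = D q i" if "i < l" "q < l" for i q
  proof -
    have "inner_root G (x i) (\<tau> q) = (\<Sum>p<l. N p i * (\<Sum>j<l. D p j * D q j))"
      unfolding x_def using that by (subst inner_root_comb) (auto simp: \<tau> gram)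
    also have "\<dots> = (\<Sum>j<l. (\<Sum>p<l. N p i * D p j) * D q j)"
      by (simp add: sum_distrib_left sum_distrib_right mult.assoc) (rule sum.swap)
    also have "\<dots> = (\<Sum>j<l. if j = i then D q j else 0)"
      using that by (intro sum.cong) (auto simp: D_dual_right)
    finally show ?thesis using that by simp
  qed
  show "orthonormal G l x"
    unfolding orthonormal_def
  proof (intro conjI allI impI)
    fix i j assume ij: "i < l" "j < l"
    have xi: "x i \<in> carrier_vec ?n" by (simp add: x_def)
    have "inner_root G (x i) (x j) = (\<Sum>p<l. N p j * D p i)"
      by (subst x_def, subst inner_root_comb_right) (use xi \<tau> xt ij in auto)
    then show "inner_root G (x i) (x j) = of_bool (i = j)"
      using ij by (simp add: D_dual_right)
  qed (simp add: x_def)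
  show "\<tau> q = comb ?n l (D q) x" if "q < l" for q
    unfolding combx
  proof (rule eq_vecI)
    fix r assume "r < dim_vec (comb ?n l (\<lambda>p. \<Sum>j<l. D q j * N p j) \<tau>)"
    then have r: "r < ?n" by (simp add: comb_def)
    have "(\<Sum>p<l. (\<Sum>j<l. D q j * N p j) * \<tau> p $ r) = (\<Sum>p<l. if p = q then \<tau> p $ r else 0)"
      using that by (intro sum.cong) (auto simp: D_dual_left)
    then show "\<tau> q $ r = comb ?n l (\<lambda>p. \<Sum>j<l. D q j * N p j) \<tau> $ r"
      using r that by (simp add: comb_def)
  qed (use \<tau>[OF that] in \<open>simp add: comb_def\<close>)
qed

end

section \<open>Linkages in coordinates\<close>

text \<open>All that is used about the diagram, so that D_l and every D_l(a_k) are treated at once.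
  Since \<open>cartan\<close> tests solid edges first, \<open>disjoint\<close> is what makes dotted
  edges readable from it.\<close>

locale realization = D_coords +
  fixes \<Gamma> :: diagram
  assumes nodes: "num_nodes \<Gamma> = l"
    and disjoint: "solid \<Gamma> \<inter> dotted \<Gamma> = {}"
    and cartan_gram: "p < l \<Longrightarrow> q < l \<Longrightarrow> cartan \<Gamma> $$ (p, q) = (\<Sum>j<l. D p j * D q j)"
begin

lemma gamma_set_gram:
  assumes "gamma_set \<Gamma> G \<tau>" "p < l" "q < l"
  shows "inner_root G (\<tau> p) (\<tau> q) = (\<Sum>j<l. D p j * D q j)"
proof (cases "p = q")
  case True
  then show ?thesis
    using assms nodes roots_norm[of "\<tau> p" G]
    by (simp add: gamma_set_def cartan_gram[symmetric] cartan_diag)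
next
  case False
  then have "inner_root G (\<tau> p) (\<tau> q) = cartan \<Gamma> $$ (p, q)"
    using assms nodes disjoint unfolding gamma_set_def cartan_def by auto
  then show ?thesis using assms by (simp add: cartan_gram)
qed

text \<open>Besides the numerical constraints the conclusion keeps the root \<open>g\<close> and the
  frame that produced \<open>c\<close>: \<open>D_partial_subset_units\<close> needs the frame itself
  to exclude half-odd coordinates.\<close>

lemma linkage_coords:
  assumes pd: "pos_def G" and \<tau>: "gamma_set \<Gamma> G \<tau>" and v: "v \<in> linkages_of_set \<Gamma> G \<tau>"
  obtains g c where "g \<in> roots G" "v = lab c"
    "\<And>j. j < l \<Longrightarrow> c j = inner_root G g (comb (num_nodes G) l (\<lambda>p. N p j) \<tau>)"
    "(\<Sum>j<l. c j ^ 2) < 2" "\<exists>j<l. c j \<noteq> 0"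
    "\<And>j. j < l \<Longrightarrow> 2 * c j \<in> \<int>" "\<And>i j. i < l \<Longrightarrow> j < l \<Longrightarrow> c i - c j \<in> \<int>"
proof -
  let ?n = "num_nodes G"
  have root: "p < l \<Longrightarrow> \<tau> p \<in> roots G" for p
    using \<tau> nodes by (simp add: gamma_set_def)
  note car = roots_carrier[OF root]
  obtain g where g: "g \<in> roots G" and
    nspan: "g \<notin> LinearCombinations.module.span class_ring (module_vec TYPE(real) ?n) (\<tau> ` {..<l})"
    and v: "v = linkage_labels \<Gamma> G \<tau> g" "v \<noteq> 0\<^sub>v l"
    using v nodes unfolding linkages_of_set_def by auto
  define x where "x = (\<lambda>j. comb ?n l (\<lambda>p. N p j) \<tau>)"
  define c where "c = (\<lambda>j. inner_root G g (x j))"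
  have frame: "orthonormal G l x" "q < l \<Longrightarrow> \<tau> q = comb ?n l (D q) x"
    "comb ?n l b x = comb ?n l (\<lambda>p. \<Sum>j<l. b j * N p j) \<tau>" for q b
    unfolding x_def by (rule frame_of_basis; simp add: car gamma_set_gram[OF \<tau>])+
  have gc: "g \<in> carrier_vec ?n" using g by (rule roots_carrier)
  have vc: "v = lab c"
  proof (rule eq_vecI)
    fix q assume "q < dim_vec (lab c)"
    then have q: "q < l" by (simp add: lab_def)
    have "inner_root G g (\<tau> q) = inner_root G g (comb ?n l (D q) x)"
      using frame(2)[OF q] by simp
    also have "\<dots> = (\<Sum>j<l. D q j * c j)"
      unfolding c_def by (subst inner_root_comb_right) (use gc in \<open>auto simp: x_def\<close>)
    finally show "v $ q = lab c $ q"
      using q nodes by (simp add: v lab_def linkage_labels_def)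
  qed (simp add: v lab_def linkage_labels_def nodes)
  have csum: "c j = (\<Sum>p<l. N p j * inner_root G g (\<tau> p))" for j
    unfolding c_def x_def by (subst inner_root_comb_right) (use gc car in auto)
  have int: "p < l \<Longrightarrow> inner_root G g (\<tau> p) \<in> \<int>" for p
    using roots_inner_Ints[OF g root] by simp
  have "g \<noteq> comb ?n l c x"
  proof
    assume "g = comb ?n l c x"
    moreover have "inj_on \<tau> {..<l}" using \<tau> nodes by (simp add: gamma_set_def)
    ultimately show False
      using nspan car frame(3) by (auto simp: span_family)
  qed
  then have less2: "(\<Sum>j<l. c j ^ 2) < 2"
    using bessel[OF frame(1) gc _ pd, of c] roots_norm[OF g] by (simp add: c_def)
  have "\<exists>j<l. c j \<noteq> 0"
  proof (rule ccontr)
    assume "\<not> ?thesis"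
    then have "v = 0\<^sub>v l" unfolding vc lab_def by (intro eq_vecI) auto
    then show False using v by simp
  qed
  moreover have "2 * c j \<in> \<int>" for j
  proof -
    have "2 * c j = (\<Sum>p<l. (2 * N p j) * inner_root G g (\<tau> p))"
      by (simp add: csum sum_distrib_left mult.assoc)
    also have "\<dots> \<in> \<int>" by (intro Ints_sum Ints_mult[OF N_Ints(1) int]) auto
    finally show ?thesis .
  qed
  moreover have "c i - c j \<in> \<int>" for i j
  proof -
    have "c i - c j = (\<Sum>p<l. (N p i - N p j) * inner_root G g (\<tau> p))"
      by (simp add: csum sum_subtractf left_diff_distrib)
    also have "\<dots> \<in> \<int>" by (intro Ints_sum Ints_mult[OF N_Ints(2) int]) auto
    finally show ?thesis .
  qed
  ultimately show ?thesis
    using that[OF g vc _ less2] by (auto simp: c_def x_def)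
qed

end

section \<open>Short vectors\<close>

lemma half_odd_bounds:
  fixes c :: real
  assumes "2 * c \<in> \<int>" "c \<notin> \<int>"
  shows "\<bar>c\<bar> = 1 / 2 \<or> 3 / 2 \<le> \<bar>c\<bar>"
proof -
  obtain m :: int where m: "2 * c = of_int m" using assms(1) by (auto elim: Ints_cases)
  have "odd m"
  proof
    assume "even m"
    then obtain r where "m = 2 * r" by blast
    then have "c = of_int r" using m by simp
    then show False using assms(2) by simp
  qed
  then have "\<bar>m\<bar> = 1 \<or> 3 \<le> \<bar>m\<bar>" by presburger
  then show ?thesis using m by linarith
qed

context D_coords
begin

text \<open>The weights +-e_i of the vector representation of D_l, written as labels.\<close>

definition units :: "real vec set" where
  "units = (\<lambda>(i, s). lab (\<lambda>j. if j = i then s else 0)) ` ({..<l} \<times> {1, -1})"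

definition spin :: "nat set \<Rightarrow> real vec" where
  "spin A = lab (\<lambda>j. if j \<in> A then - 1 / 2 else 1 / 2)"

text \<open>The weights of one of the two half-spin representations of D_l; \<open>b\<close> fixes
  the parity of the number of minus signs, which paired sign changes preserve.\<close>

definition half_spins :: "bool \<Rightarrow> real vec set" where
  "half_spins b = spin ` {A. A \<subseteq> {..<l} \<and> even (card A) = b}"

text \<open>Every nonzero integer coordinate contributes at least 1 to a sum below 2, so there is
  exactly one, and its square is below 2.\<close>

lemma integral_short:
  assumes "\<And>j. j < l \<Longrightarrow> c j \<in> \<int>" "(\<Sum>j<l. c j ^ 2) < 2" "\<exists>j<l. c j \<noteq> 0"
  shows "lab c \<in> units"
proof -
  have ge: "1 \<le> c j ^ 2" if "j < l" "c j \<noteq> 0" for j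
  proof -
    have "1 \<le> \<bar>c j\<bar>" using that assms(1) by (simp add: Ints_nonzero_abs_ge1)
    then show ?thesis by (metis one_le_power power2_abs)
  qed
  obtain i where i: "i < l" "c i \<noteq> 0" using assms(3) by auto
  have sum: "(\<Sum>j<l. c j ^ 2) = c i ^ 2 + (\<Sum>j\<in>{..<l} - {i}. c j ^ 2)"
    using i by (simp add: sum.remove)
  have zero: "c j = 0" if "j < l" "j \<noteq> i" for j
  proof (rule ccontr)
    assume "c j \<noteq> 0"
    moreover have "c j ^ 2 \<le> (\<Sum>j\<in>{..<l} - {i}. c j ^ 2)"
      using that by (intro member_le_sum) auto
    ultimately show False using ge[OF i] ge[of j] sum assms(2) that by simp
  qed
  have "c i ^ 2 < 2" using sum assms(2) sum_nonneg[of "{..<l} - {i}" "\<lambda>j. c j ^ 2"] by simp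
  obtain m :: int where m: "c i = of_int m" using assms(1)[OF i(1)] by (auto elim: Ints_cases)
  have "m ^ 2 < 2"
    using \<open>c i ^ 2 < 2\<close> m by (metis of_int_less_numeral_iff of_int_power)
  have "\<bar>m\<bar> < 2"
  proof (rule ccontr)
    assume "\<not> \<bar>m\<bar> < 2"
    then have "2 * 2 \<le> \<bar>m\<bar> * \<bar>m\<bar>" by (intro mult_mono) auto
    then show False using \<open>m ^ 2 < 2\<close> by (simp add: power2_eq_square)
  qed
  then have "c i = 1 \<or> c i = -1" using m i by auto
  moreover have "lab c = lab (\<lambda>j. if j = i then c i else 0)"
    by (rule lab_cong) (use zero in auto)
  ultimately show ?thesis using i(1) unfolding units_def by force
qed

text \<open>A half-odd coordinate other than +-1/2 would contribute at least 9/4, so all are +-1/2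
  and l/4 < 2, whence l <= 7. The second alternative records that \<open>c 0\<close> is not
  integral, so that a later proof of its integrality refutes this alternative.\<close>

lemma short_cases:
  assumes "\<And>j. j < l \<Longrightarrow> 2 * c j \<in> \<int>" "\<And>i j. i < l \<Longrightarrow> j < l \<Longrightarrow> c i - c j \<in> \<int>"
    "(\<Sum>j<l. c j ^ 2) < 2" "\<exists>j<l. c j \<noteq> 0"
  shows "lab c \<in> units \<or> (l \<le> 7 \<and> c 0 \<notin> \<int> \<and> lab c \<in> half_spins True \<union> half_spins False)"
proof (cases "c 0 \<in> \<int>")
  case True
  have "c j \<in> \<int>" if "j < l" for j
    using Ints_add[OF assms(2)[of j 0] True] that by simp
  then show ?thesis using integral_short assms by blast
next
  case False
  have nonint: "c j \<notin> \<int>" if "j < l" for j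
  proof
    assume "c j \<in> \<int>"
    from Ints_add[OF assms(2)[of 0 j] this] False that show False by simp
  qed
  have half: "\<bar>c j\<bar> = 1 / 2" if "j < l" for j
  proof (rule ccontr)
    assume "\<bar>c j\<bar> \<noteq> 1 / 2"
    then have "3 / 2 \<le> \<bar>c j\<bar>" using half_odd_bounds assms(1) nonint that by blast
    then have "(3 / 2) * (3 / 2) \<le> \<bar>c j\<bar> * \<bar>c j\<bar>" by (intro mult_mono) auto
    moreover have "c j ^ 2 \<le> (\<Sum>j<l. c j ^ 2)" using that by (intro member_le_sum) auto
    ultimately show False using assms(3) by (simp add: power2_eq_square)
  qed
  have "(\<Sum>j<l. c j ^ 2) = (\<Sum>j<l. 1 / 4)"
  proof (rule sum.cong)
    fix j assume "j \<in> {..<l}"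
    then have "\<bar>c j\<bar> = 1 / 2" using half by blast
    then have "\<bar>c j\<bar> * \<bar>c j\<bar> = 1 / 4" by (simp only:)
    then show "c j ^ 2 = 1 / 4" by (simp add: power2_eq_square)
  qed simp
  then have "l \<le> 7" using assms(3) by simp
  have "lab c = spin {j. j < l \<and> c j < 0}"
    unfolding spin_def
  proof (rule lab_cong)
    fix j assume "j < l"
    then show "c j = (if j \<in> {j. j < l \<and> c j < 0} then - 1 / 2 else 1 / 2)"
      using half[of j] by (auto split: abs_split)
  qed
  moreover have "{j. j < l \<and> c j < 0} \<subseteq> {..<l}" by auto
  ultimately have "lab c \<in> half_spins True \<union> half_spins False"
    unfolding half_spins_def by blast
  then show ?thesis using \<open>l \<le> 7\<close> False by simp
qed

lemma spin_inj: "inj_on spin (Pow {..<l})"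
proof (rule inj_onI)
  fix A B assume AB: "A \<in> Pow {..<l}" "B \<in> Pow {..<l}" "spin A = spin B"
  have "j \<in> A \<longleftrightarrow> j \<in> B" if "j < l" for j
    using lab_inj[OF AB(3)[unfolded spin_def] that] by (auto split: if_splits)
  then show "A = B" using AB by auto
qed

lemma card_even_subsets: "card {A. A \<subseteq> {..<l} \<and> even (card A) = b} = 2 ^ (l - 1)"
proof -
  have eq: "card {A. A \<subseteq> {..<l} \<and> even (card A)} = card {A. A \<subseteq> {..<l} \<and> odd (card A)}"
  proof -
    have "{} \<subset> {..<l}" using k_less by blast
    from card_subsupersets_even_odd[OF _ this] show ?thesis by simp
  qed
  have "Pow {..<l} = {A. A \<subseteq> {..<l} \<and> even (card A)} \<union> {A. A \<subseteq> {..<l} \<and> odd (card A)}"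
    by auto
  then have "card (Pow {..<l}) =
      card {A. A \<subseteq> {..<l} \<and> even (card A)} + card {A. A \<subseteq> {..<l} \<and> odd (card A)}"
    by (simp only:) (rule card_Un_disjoint, auto)
  then have "2 * card {A. A \<subseteq> {..<l} \<and> even (card A)} = 2 * 2 ^ (l - 1)"
    using eq k_less by (simp add: card_Pow flip: power_Suc)
  then show ?thesis using eq by (cases b) auto
qed

lemma card_half_spins: "card (half_spins b) = 2 ^ (l - 1)"
  unfolding half_spins_def
  by (subst card_image) (auto intro: inj_on_subset[OF spin_inj] simp: card_even_subsets)

lemma half_spins_disjoint: "half_spins True \<inter> half_spins False = {}"
proof -
  have "A = B" if "spin A = spin B" "A \<subseteq> {..<l}" "B \<subseteq> {..<l}" for A B
    using inj_onD[OF spin_inj that(1)] that by simp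
  then show ?thesis unfolding half_spins_def by fastforce
qed

lemma card_units: "card units = 2 * l"
proof -
  have "inj_on (\<lambda>(i, s). lab (\<lambda>j. if j = i then s else 0)) ({..<l} \<times> {1, -1})"
  proof (rule inj_onI)
    fix x y
    assume xy: "x \<in> {..<l} \<times> {1, -1::real}" "y \<in> {..<l} \<times> {1, -1::real}"
      "(case x of (i, s) \<Rightarrow> lab (\<lambda>j. if j = i then s else 0)) =
       (case y of (i, s) \<Rightarrow> lab (\<lambda>j. if j = i then s else 0))"
    obtain i s i' s' where xy': "x = (i, s)" "y = (i', s')" by (cases x, cases y)
    then have "lab (\<lambda>j. if j = i then s else 0) = lab (\<lambda>j. if j = i' then s' else 0)" "i < l"
      "s \<noteq> 0"
      using xy by auto
    from lab_inj[OF this(1,2)] this(3) show "x = y" using xy' by (auto split: if_splits)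
  qed
  then show ?thesis
    unfolding units_def by (simp add: card_image card_cartesian_product)
qed

lemma units_half_spins_disjoint: "units \<inter> half_spins b = {}"
proof -
  have False if "i < l" "lab (\<lambda>j. if j = i then s else 0) = spin A" "s = 1 \<or> s = -1" for i s A
    using lab_inj[OF that(2)[unfolded spin_def] that(1)] that(3) by (auto split: if_splits)
  then show ?thesis unfolding units_def half_spins_def by fastforce
qed

lemma units_carrier: "units \<subseteq> carrier_vec l" and half_spins_carrier: "half_spins b \<subseteq> carrier_vec l"
  by (auto simp: units_def half_spins_def spin_def)

end


section \<open>Orbits of the dual Weyl group\<close>

lemma cartan_dim [simp]: "dim_row (cartan G) = num_nodes G" "dim_col (cartan G) = num_nodes G"
  by (simp_all add: cartan_def)

lemma cartan_unit_index:
  assumes "i < num_nodes G" "p < num_nodes G"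
  shows "(cartan G *\<^sub>v unit_vec (num_nodes G) i) $ p = cartan G $$ (p, i)"
  using assms by (simp add: cartan_def)

lemma involutions_dual_reflection: "involutions (num_nodes G) (dual_reflection G)"
proof
  fix i and x :: "real vec"
  assume i: "i < num_nodes G" and x: "x \<in> carrier_vec (num_nodes G)"
  have car: "cartan G *\<^sub>v unit_vec (num_nodes G) i \<in> carrier_vec (num_nodes G)"
    by (rule mult_mat_vec_carrier[of _ _ "num_nodes G"]) (simp_all add: cartan_def)
  then show "dual_reflection G i x \<in> carrier_vec (num_nodes G)"
    using x by (simp add: dual_reflection_def)
  have "dual_reflection G i x $ i = - x $ i"
    using i x car by (simp add: dual_reflection_def cartan_unit_index cartan_diag del: index_mult_mat_vec)
  then show "dual_reflection G i (dual_reflection G i x) = x"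
    using x car by (simp add: dual_reflection_def) (intro eq_vecI, auto)
qed

text \<open>The reflection in e_i + e_j, in coordinates.\<close>

definition neg_swap :: "nat \<Rightarrow> nat \<Rightarrow> (nat \<Rightarrow> real) \<Rightarrow> nat \<Rightarrow> real" where
  "neg_swap i j c = (\<lambda>r. if r = i then - c j else if r = j then - c i else c r)"

lemma ex_permutes_pair:
  assumes "i \<noteq> j" "a \<noteq> b" "i \<in> S" "j \<in> S" "a \<in> S" "b \<in> S"
  shows "\<exists>\<pi>. \<pi> permutes S \<and> \<pi> i = a \<and> \<pi> j = b"
proof (intro exI conjI)
  \<comment> \<open>The outer swap sends \<open>i\<close> to \<open>a\<close>; the inner one sends
    \<open>j\<close> to the preimage of \<open>b\<close> under the outer swap, and it fixes
    \<open>i\<close> because \<open>a\<close> and \<open>b\<close> differ.\<close>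
  let ?\<pi> = "Transposition.transpose a i \<circ> Transposition.transpose j (Transposition.transpose a i b)"
  show "?\<pi> permutes S"
    using assms by (intro permutes_compose permutes_swap_id) (auto simp: transpose_def)
  show "?\<pi> i = a" "?\<pi> j = b"
    using assms by (auto simp: transpose_def)
qed

lemma even_card_sym_diff:
  assumes "finite A" "finite B"
  shows "even (card (sym_diff A B)) \<longleftrightarrow> even (card A) = even (card B)"
proof -
  have "card A = card (A - B) + card (A \<inter> B)" "card B = card (B - A) + card (A \<inter> B)"
    using assms by (auto simp: card_Diff_subset_Int Int_commute card_mono)
  moreover have "card (sym_diff A B) = card (A - B) + card (B - A)"
    using assms by (intro card_Un_disjoint) auto
  ultimately show ?thesis by (simp, blast)
qed

section \<open>Permutations and paired sign changes from basis reflections\<close>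

context D_coords
begin

text \<open>The sign of a basis vector enters its reflection twice and cancels, so every choice of
  \<epsilon> gives the same reflections as the unsigned basis.\<close>

lemma reflect_coords:
  assumes "i < l"
  shows "c j - (\<Sum>r<l. D i r * c r) * D i j =
    (if i = l - 1 then neg_swap k (Suc k) c else c \<circ> Transposition.transpose i (Suc i)) j"
proof -
  have rearrange: "a * x * (a * y) = a * a * (x * y)" for a x y :: real
    by simp
  have "(\<Sum>r<l. D i r * c r) * D i j =
      (\<epsilon> i * \<epsilon> i) * ((if i = l - 1 then c k + c (Suc k) else c i - c (Suc i)) *
        (if i = l - 1 then of_bool (j = k) + of_bool (j = Suc k)
         else of_bool (j = i) - of_bool (j = Suc i)))"
    unfolding sum_D_basis[OF assms] unfolding D_basis_def by (rule rearrange)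
  then show ?thesis
    unfolding sign_square by (cases "i = l - 1") (auto simp: neg_swap_def transpose_def)
qed

text \<open>Stated for an arbitrary predicate because it is applied both to labels in an invariant
  set and to coordinates of roots.\<close>

definition closed_coords :: "((nat \<Rightarrow> real) \<Rightarrow> bool) \<Rightarrow> bool" where
  "closed_coords P \<longleftrightarrow> (\<forall>c. P c \<longrightarrow> P (neg_swap k (Suc k) c) \<and>
     (\<forall>i. Suc i < l \<longrightarrow> P (c \<circ> Transposition.transpose i (Suc i))))"

lemma closed_coordsI:
  assumes "\<And>i c. i < l \<Longrightarrow> P c \<Longrightarrow> P (\<lambda>j. c j - (\<Sum>r<l. D i r * c r) * D i j)"
  shows "closed_coords P"
proof -
  have "P (if i = l - 1 then neg_swap k (Suc k) c else c \<circ> Transposition.transpose i (Suc i))"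
    if "i < l" "P c" for i c
    using assms[OF that] unfolding reflect_coords[OF that(1)] .
  note step = this
  show ?thesis
    unfolding closed_coords_def
  proof (intro allI impI conjI)
    fix c assume c: "P c"
    show "P (neg_swap k (Suc k) c)"
      using step[OF _ c, of "l - 1"] k_less by simp
    fix i assume i: "Suc i < l"
    then have "i < l" "i \<noteq> l - 1" by auto
    then show "P (c \<circ> Transposition.transpose i (Suc i))"
      using step[OF _ c, of i] by (simp only: if_False)
  qed
qed

lemma closed_transpose:
  assumes S: "closed_coords P"
  shows "P c \<Longrightarrow> i < j \<Longrightarrow> j < l \<Longrightarrow> P (c \<circ> Transposition.transpose i j)"
proof (induction j arbitrary: c)
  case (Suc j)
  have adjacent: "P (c \<circ> Transposition.transpose i (Suc i))" if "P c" "Suc i < l" for c i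
    using S that by (simp add: closed_coords_def)
  show ?case
  proof (cases "i = j")
    case True
    show ?thesis using adjacent[OF Suc.prems(1,3)] unfolding True .
  next
    case False
    \<comment> \<open>The transposition (i, j+1) is the conjugate of (i, j) by the adjacent
      transposition (j, j+1).\<close>
    have "c \<circ> Transposition.transpose i (Suc j) =
      ((c \<circ> Transposition.transpose j (Suc j)) \<circ> Transposition.transpose i j) \<circ> Transposition.transpose j (Suc j)"
      using False Suc.prems by (auto simp: fun_eq_iff transpose_def)
    moreover have "P \<dots>"
      by (rule adjacent[OF Suc.IH[OF adjacent[OF Suc.prems(1)]]])
        (use False Suc.prems in auto)
    ultimately show ?thesis by (simp only:)
  qed
qed simp

lemma closed_permutes:
  assumes S: "closed_coords P" and \<pi>: "\<pi> permutes {..<l}" and c: "P c"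
  shows "P (c \<circ> \<pi>)"
proof -
  have "\<forall>c. P c \<longrightarrow> P (c \<circ> \<pi>)"
    using \<pi> finite_lessThan
  proof (induction rule: permutes_induct)
    case (swap a b p)
    have ab: "a < l" "b < l" using swap by auto
    have "P (c \<circ> Transposition.transpose a b)" if "P c" for c
    proof (cases "a < b")
      case True
      then show ?thesis using closed_transpose[OF S that] ab by blast
    next
      case False
      then have "b < a" using swap by simp
      then show ?thesis
        using closed_transpose[OF S that] ab unfolding transpose_commute[of a b] by blast
    qed
    then show ?case unfolding o_assoc using swap.IH by blast
  qed simp
  then show ?thesis using c by blast
qed

text \<open>Conjugating the single available reflection in e_k + e_(k+1) by a permutation that
  carries the pair k, k+1 to i, j gives the reflection in e_i + e_j.\<close>

lemma closed_neg_swap: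
  assumes S: "closed_coords P" and c: "P c" and ij: "i < l" "j < l" "i \<noteq> j"
  shows "P (neg_swap i j c)"
proof -
  obtain \<rho> where perm: "\<rho> permutes {..<l}" and "\<rho> k = i" "\<rho> (Suc k) = j"
    using ex_permutes_pair[of k "Suc k" i j "{..<l}"] ij k_less by auto
  then have inv: "inv_into UNIV \<rho> i = k" "inv_into UNIV \<rho> j = Suc k"
    using permutes_inv_eq[OF perm] by auto
  have "P (neg_swap k (Suc k) (c \<circ> \<rho>))"
    using S[unfolded closed_coords_def] closed_permutes[OF S perm c] by blast
  then have "P (neg_swap k (Suc k) (c \<circ> \<rho>) \<circ> inv_into UNIV \<rho>)"
    by (rule closed_permutes[OF S permutes_inv[OF perm]])
  moreover have "neg_swap k (Suc k) (c \<circ> \<rho>) \<circ> inv_into UNIV \<rho> = neg_swap i j c"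
  proof
    fix r
    have "inv_into UNIV \<rho> r = k \<longleftrightarrow> r = i" "inv_into UNIV \<rho> r = Suc k \<longleftrightarrow> r = j" "\<rho> (inv_into UNIV \<rho> r) = r"
      using permutes_inv_eq[OF perm] permutes_inverses[OF perm] \<open>\<rho> k = i\<close> \<open>\<rho> (Suc k) = j\<close>
      by auto
    then show "(neg_swap k (Suc k) (c \<circ> \<rho>) \<circ> inv_into UNIV \<rho>) r = neg_swap i j c r"
      using \<open>\<rho> k = i\<close> \<open>\<rho> (Suc k) = j\<close> by (simp add: neg_swap_def)
  qed
  ultimately show ?thesis by simp
qed

end

section \<open>The dual Weyl group in coordinates and its orbits\<close>

context realization
begin

text \<open>Column \<open>i\<close> of the Cartan matrix is \<open>lab (D i)\<close>, and entry
  \<open>i\<close> of \<open>lab c\<close> is the inner product of \<open>c\<close> with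
  \<open>D i\<close>; so the dual reflection is the ordinary reflection in \<open>D i\<close> seen
  through \<open>lab\<close>.\<close>

lemma dual_reflection_lab:
  assumes "i < l"
  shows "dual_reflection \<Gamma> i (lab c) =
    lab (if i = l - 1 then neg_swap k (Suc k) c else c \<circ> Transposition.transpose i (Suc i))"
proof -
  define t where "t = (\<Sum>j<l. D i j * c j)"
  have "dual_reflection \<Gamma> i (lab c) = lab (\<lambda>j. c j - t * D i j)"
  proof (rule eq_vecI)
    fix p assume "p < dim_vec (lab (\<lambda>j. c j - t * D i j))"
    then have p: "p < l" by (simp add: lab_def)
    have "dual_reflection \<Gamma> i (lab c) $ p = (\<Sum>j<l. D p j * c j) - t * (\<Sum>j<l. D p j * D i j)"
      using p assms cartan_unit_index[of i \<Gamma> p] cartan_gram[OF p assms]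
      by (simp add: dual_reflection_def lab_def nodes t_def cartan_def del: index_mult_mat_vec)
    then show "dual_reflection \<Gamma> i (lab c) $ p = lab (\<lambda>j. c j - t * D i j) $ p"
      using p by (simp add: lab_def right_diff_distrib sum_subtractf sum_distrib_left mult_ac)
  qed (simp add: dual_reflection_def lab_def cartan_def nodes)
  also have "\<dots> = lab (if i = l - 1 then neg_swap k (Suc k) c else c \<circ> Transposition.transpose i (Suc i))"
    unfolding t_def reflect_coords[OF assms] ..
  finally show ?thesis .
qed

definition invariant :: "real vec set \<Rightarrow> bool" where
  "invariant S \<longleftrightarrow> (\<forall>i<l. \<forall>v\<in>S. dual_reflection \<Gamma> i v \<in> S)"

lemma closed_of_invariant:
  assumes "invariant S"
  shows "closed_coords (\<lambda>c. lab c \<in> S)"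
proof (rule closed_coordsI)
  fix i c assume i: "i < l" and c: "lab c \<in> S"
  show "lab (\<lambda>j. c j - (\<Sum>r<l. D i r * c r) * D i j) \<in> S"
    using assms i c dual_reflection_lab[OF i, of c] unfolding reflect_coords[OF i] invariant_def
    by metis
qed

lemmas invariant_permutes = closed_permutes[OF closed_of_invariant]
  and invariant_neg_swap = closed_neg_swap[OF closed_of_invariant]

lemma units_transitive:
  assumes S: "invariant S" and v: "v \<in> S" "v \<in> units" and w: "w \<in> units"
  shows "w \<in> S"
proof -
  let ?u = "\<lambda>i s. lab (\<lambda>j. if j = i then s else 0)"
  obtain i s where iv: "i < l" "s = 1 \<or> s = -1" "v = ?u i s"
    using v by (auto simp: units_def)
  obtain j t where jt: "j < l" "t = 1 \<or> t = -1" "w = ?u j t"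
    using w by (auto simp: units_def)
  have perm: "?u b r \<in> S" if "?u a r \<in> S" "a < l" "b < l" for a b r
  proof -
    have "(\<lambda>j. if j = a then r else 0) \<circ> Transposition.transpose a b = (\<lambda>j. if j = b then r else 0)"
      by (auto simp: fun_eq_iff transpose_def)
    then show ?thesis
      using invariant_permutes[OF S permutes_swap_id[of a "{..<l}" b] that(1)] that by simp
  qed
  have neg: "?u b (- r) \<in> S" if "?u a r \<in> S" "a < l" "b < l" "a \<noteq> b" for a b r
  proof -
    have "neg_swap a b (\<lambda>j. if j = a then r else 0) = (\<lambda>j. if j = b then - r else 0)"
      using that by (auto simp: neg_swap_def)
    then show ?thesis using invariant_neg_swap[OF S that] by simp
  qed
  \<comment> \<open>A unit vector changes sign only while moving to another index, so a second index
    is required as a stopover.\<close>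
  obtain m where m: "m < l" "m \<noteq> i"
    using k_less by (metis Suc_lessD n_not_Suc_n)
  have "?u m (- s) \<in> S" using neg[of i s m] v iv m by simp
  then have "?u j (- s) \<in> S" using perm m jt by blast
  moreover have "?u j s \<in> S" using perm[of i s j] v iv jt by simp
  moreover have "t = s \<or> t = - s" using iv jt by auto
  ultimately show ?thesis unfolding jt(3) by (elim disjE) (simp_all only:)
qed

text \<open>The signs at any two indices can be flipped together: by \<open>neg_swap\<close> if they
  are equal, by a transposition if they differ. Equal parity makes the set of disagreements even, so
  it can be removed two indices at a time.\<close>

lemma half_spins_transitive:
  assumes S: "invariant S" and v: "v \<in> S" "v \<in> half_spins b" and w: "w \<in> half_spins b"
  shows "w \<in> S"
proof -
  have toggle: "spin (sym_diff A {i, j}) \<in> S"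
    if "spin A \<in> S" "i < l" "j < l" "i \<noteq> j" for A i j
  proof (cases "i \<in> A \<longleftrightarrow> j \<in> A")
    case True
    have "neg_swap i j (\<lambda>r. if r \<in> A then - 1 / 2 else 1 / 2) =
        (\<lambda>r. if r \<in> sym_diff A {i, j} then - 1 / 2 else 1 / 2)"
      using True that by (auto simp: neg_swap_def fun_eq_iff)
    then show ?thesis
      using invariant_neg_swap[OF S that(1)[unfolded spin_def] that(2-4)] by (simp add: spin_def)
  next
    case False
    have "(\<lambda>r. if r \<in> A then - 1 / 2 else 1 / 2) \<circ> Transposition.transpose i j =
        (\<lambda>r. if r \<in> sym_diff A {i, j} then - 1 / 2 else 1 / 2 :: real)"
      using False that by (auto simp: transpose_def fun_eq_iff)
    then show ?thesis
      using invariant_permutes[OF S permutes_swap_id[of i "{..<l}" j] that(1)[unfolded spin_def]] that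
      by (simp add: spin_def)
  qed
  have main: "spin B \<in> S"
    if "spin A \<in> S" "A \<subseteq> {..<l}" "B \<subseteq> {..<l}" "even (card (sym_diff A B))" for A B
    using that
  proof (induction "card (sym_diff A B)" arbitrary: A rule: less_induct)
    case less
    have fin: "finite (sym_diff A B)"
      using less.prems by (auto intro: finite_subset)
    show ?case
    proof (cases "sym_diff A B = {}")
      case True
      then have "A = B" by auto
      then show ?thesis using less.prems by simp
    next
      case False
      then obtain i where i: "i \<in> sym_diff A B" by blast
      \<comment> \<open>Evenness excludes a lone disagreement, which supplies a partner
        \<open>j\<close> to flip together with \<open>i\<close>.\<close>
      have "sym_diff A B \<noteq> {i}" using less.prems(4) by auto
      then obtain j where j: "j \<in> sym_diff A B" "j \<noteq> i" using i by blast
      have ijl: "i < l" "j < l" using i j less.prems by auto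
      have diff: "sym_diff (sym_diff A {i, j}) B = sym_diff A B - {i, j}"
        using i j by auto
      have ij: "{i, j} \<subseteq> sym_diff A B" using i j by simp
      have card: "card (sym_diff A B - {i, j}) = card (sym_diff A B) - 2"
        using card_Diff_subset[OF _ ij] j by simp
      have "2 \<le> card (sym_diff A B)"
        using card_mono[OF fin ij] j by simp
      show ?thesis
      proof (rule less.hyps[of "sym_diff A {i, j}"])
        show "spin (sym_diff A {i, j}) \<in> S"
          using toggle[OF less.prems(1) ijl] j by simp
        show "sym_diff A {i, j} \<subseteq> {..<l}" using less.prems ijl by auto
        show "card (sym_diff (sym_diff A {i, j}) B) < card (sym_diff A B)"
          "even (card (sym_diff (sym_diff A {i, j}) B))"
          using \<open>2 \<le> card (sym_diff A B)\<close> less.prems(4) by (simp_all only: diff card) auto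
      qed (rule less.prems(3))
    qed
  qed
  obtain A where A: "A \<subseteq> {..<l}" "even (card A) = b" "v = spin A"
    using v by (auto simp: half_spins_def)
  obtain B where B: "B \<subseteq> {..<l}" "even (card B) = b" "w = spin B"
    using w by (auto simp: half_spins_def)
  have "even (card (sym_diff A B))"
    using A B by (subst even_card_sym_diff) (auto intro: finite_subset)
  then show ?thesis using main[of A B] A B v by simp
qed

lemma invariant_units: "invariant units"
  unfolding invariant_def
proof (intro allI impI ballI)
  fix i v assume i: "i < l" and "v \<in> units"
  then obtain a s where a: "a < l" "s = 1 \<or> s = -1" "v = lab (\<lambda>j. if j = a then s else 0)"
    by (auto simp: units_def)
  let ?c' = "if i = l - 1 then neg_swap k (Suc k) (\<lambda>j. if j = a then s else 0)
     else (\<lambda>j. if j = a then s else 0) \<circ> Transposition.transpose i (Suc i)"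
  have "\<exists>b t. b < l \<and> (t = 1 \<or> t = -1) \<and> ?c' = (\<lambda>j. if j = b then t else 0)"
  proof (cases "i = l - 1")
    case True
    show ?thesis
    proof (cases "a = k \<or> a = Suc k")
      case aa: True
      show ?thesis
        by (rule exI[of _ "if a = k then Suc k else k"], rule exI[of _ "- s"])
          (use True aa a(2) k_less in \<open>auto simp: neg_swap_def\<close>)
    next
      case False
      show ?thesis
        by (rule exI[of _ a], rule exI[of _ s]) (use True False a in \<open>auto simp: neg_swap_def\<close>)
    qed
  next
    case False
    show ?thesis
      by (rule exI[of _ "Transposition.transpose i (Suc i) a"], rule exI[of _ s])
        (use False a i in \<open>auto simp: transpose_def fun_eq_iff\<close>)
  qed
  then obtain b t where bt: "b < l" "t = 1 \<or> t = -1" "?c' = (\<lambda>j. if j = b then t else 0)"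
    by blast
  have "dual_reflection \<Gamma> i v = lab (\<lambda>j. if j = b then t else 0)"
    unfolding a(3) dual_reflection_lab[OF i] bt(3) ..
  then show "dual_reflection \<Gamma> i v \<in> units" using bt(1,2) unfolding units_def by force
qed

lemma invariant_half_spins: "invariant (half_spins b)"
  unfolding invariant_def
proof (intro allI impI ballI)
  fix i v assume i: "i < l" and "v \<in> half_spins b"
  then obtain A where A: "A \<subseteq> {..<l}" "even (card A) = b" "v = spin A"
    by (auto simp: half_spins_def)
  show "dual_reflection \<Gamma> i v \<in> half_spins b"
  proof (cases "i = l - 1")
    case True
    \<comment> \<open>If the signs at \<open>k\<close> and \<open>Suc k\<close> are opposite, swap
      and negation cancel and the vector is fixed.\<close>
    define A' where "A' = (if k \<in> A \<longleftrightarrow> Suc k \<in> A then sym_diff A {k, Suc k} else A)"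
    have "neg_swap k (Suc k) (\<lambda>r. if r \<in> A then - 1 / 2 else 1 / 2) =
        (\<lambda>r. if r \<in> A' then - 1 / 2 else 1 / 2)"
      by (rule ext; cases "k \<in> A"; cases "Suc k \<in> A") (simp_all add: neg_swap_def A'_def)
    then have "dual_reflection \<Gamma> i v = spin A'"
      using dual_reflection_lab[OF i] True A by (simp add: spin_def)
    moreover have "A' \<subseteq> {..<l}" using A k_less by (auto simp: A'_def)
    moreover have "even (card A') = b"
    proof (cases "k \<in> A \<longleftrightarrow> Suc k \<in> A")
      case True
      have fin: "finite A" "finite A'" using A \<open>A' \<subseteq> {..<l}\<close> by (auto intro: finite_subset)
      have "sym_diff A A' = {k, Suc k}" using True by (auto simp: A'_def)
      then have "even (card (sym_diff A A'))" by simp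
      then show ?thesis using even_card_sym_diff[OF fin] A by simp
    qed (use A in \<open>simp add: A'_def\<close>)
    ultimately show ?thesis by (auto simp: half_spins_def)
  next
    case False
    define A' where "A' = Transposition.transpose i (Suc i) ` A"
    have mem: "Transposition.transpose i (Suc i) r \<in> A \<longleftrightarrow> r \<in> A'" for r
      unfolding A'_def by (metis imageE imageI transpose_involutory)
    then have "(\<lambda>r. if r \<in> A then - 1 / 2 else 1 / 2) \<circ> Transposition.transpose i (Suc i) =
        (\<lambda>r. if r \<in> A' then - 1 / 2 else 1 / 2 :: real)"
      by (auto simp: fun_eq_iff)
    then have "dual_reflection \<Gamma> i v = spin A'"
      using dual_reflection_lab[OF i] False A by (simp add: spin_def)
    moreover have "A' \<subseteq> {..<l}" using A False i by (auto simp: A'_def transpose_def)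
    moreover have "card A' = card A"
      unfolding A'_def by (rule card_image) (rule inj_on_subset[OF inj_transpose], simp)
    ultimately show ?thesis using A by (auto simp: half_spins_def)
  qed
qed

text \<open>The orbit of \<open>x\<close> is itself an invariant set containing \<open>x\<close>, so
  the hypothesis \<open>trans\<close> applied to it gives one inclusion; orbit induction inside
  \<open>X\<close> gives the other.\<close>

lemma orbit_transitive:
  assumes X: "invariant X" "X \<subseteq> carrier_vec l" and x: "x \<in> X"
    and trans: "\<And>S y. invariant S \<Longrightarrow> x \<in> S \<Longrightarrow> y \<in> X \<Longrightarrow> y \<in> S"
  shows "orbit (dual_weyl_group \<Gamma>) (\<lambda>g. g) x = X"
proof -
  interpret involutions l "dual_reflection \<Gamma>"
    using involutions_dual_reflection[of \<Gamma>] nodes by simp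
  let ?O = "orbit (reflection_group l (dual_reflection \<Gamma>)) (\<lambda>g. g) x"
  have xC: "x \<in> carrier_vec l" using X x by auto
  have "invariant ?O" using orbit_step[OF _ xC] by (auto simp: invariant_def)
  then have "X \<subseteq> ?O" using trans[OF _ orbit_refl[OF xC]] by blast
  moreover have "?O \<subseteq> X"
    using orbit_induct[OF _ xC, of _ "\<lambda>z. z \<in> X"] x X by (auto simp: invariant_def)
  ultimately show ?thesis by (simp add: dual_weyl_group_def nodes)
qed

lemma orbit_units: "x \<in> units \<Longrightarrow> orbit (dual_weyl_group \<Gamma>) (\<lambda>g. g) x = units"
  using orbit_transitive[OF invariant_units units_carrier] units_transitive by blast

lemma orbit_half_spins:
  "x \<in> half_spins b \<Longrightarrow> orbit (dual_weyl_group \<Gamma>) (\<lambda>g. g) x = half_spins b"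
  using orbit_transitive[OF invariant_half_spins half_spins_carrier] half_spins_transitive by blast

lemma units_nonempty: "units \<noteq> {}" and half_spins_nonempty: "half_spins b \<noteq> {}"
  using card_units card_half_spins[of b] k_less by auto

lemma orbits_units: "orbits (dual_weyl_group \<Gamma>) units (\<lambda>g. g) = {units}"
proof -
  obtain x where "x \<in> units" using units_nonempty by blast
  then show ?thesis by (auto simp: orbits_def orbit_units intro!: exI[of _ x])
qed

lemma orbits_half_spins: "orbits (dual_weyl_group \<Gamma>) (half_spins b) (\<lambda>g. g) = {half_spins b}"
proof -
  obtain x where "x \<in> half_spins b" using half_spins_nonempty by blast
  then show ?thesis by (auto simp: orbits_def orbit_half_spins intro!: exI[of _ x])
qed

lemma orbits_Un: "orbits G (X \<union> Y) \<phi> = orbits G X \<phi> \<union> orbits G Y \<phi>"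
  by (auto simp: orbits_def)

lemma consists_units: "consists_of_orbits \<Gamma> units 1 (2 * l)"
  by (simp add: consists_of_orbits_def orbits_units card_units)

lemma consists_half_spins:
  "consists_of_orbits \<Gamma> (half_spins True \<union> half_spins False) 2 (2 ^ (l - 1))"
proof -
  have "half_spins True \<noteq> half_spins False"
    using half_spins_disjoint half_spins_nonempty by auto
  then show ?thesis
    by (auto simp: consists_of_orbits_def orbits_Un orbits_half_spins card_half_spins)
qed

text \<open>At \<open>l = 4\<close> the sizes 2l and 2^(l-1) coincide, so all three orbits have 8
  elements.\<close>

lemma consists_all:
  assumes "l = 4"
  shows "consists_of_orbits \<Gamma> (units \<union> (half_spins True \<union> half_spins False)) 3 8"
proof -
  have "half_spins True \<noteq> half_spins False" "units \<noteq> half_spins True" "units \<noteq> half_spins False"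
    using half_spins_disjoint half_spins_nonempty units_half_spins_disjoint units_nonempty by blast+
  then have "card {units, half_spins True, half_spins False} = 3" by simp
  moreover have "orbits (dual_weyl_group \<Gamma>) (units \<union> (half_spins True \<union> half_spins False)) (\<lambda>g. g) =
      {units, half_spins True, half_spins False}"
    by (simp only: orbits_Un orbits_half_spins orbits_units) blast
  ultimately show ?thesis
    using assms card_units card_half_spins unfolding consists_of_orbits_def by simp
qed

end

section \<open>Positive definite diagrams\<close>

definition gram_rep :: "diagram \<Rightarrow> nat \<Rightarrow> (nat \<Rightarrow> nat \<Rightarrow> real) \<Rightarrow> bool" where
  "gram_rep G m \<Phi> \<longleftrightarrow> (\<forall>i<num_nodes G. \<forall>j<num_nodes G.
     cartan G $$ (i, j) = (\<Sum>a<m. \<Phi> i a * \<Phi> j a))"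

lemma inner_root_gram:
  assumes "gram_rep G m \<Phi>" "x \<in> carrier_vec (num_nodes G)" "y \<in> carrier_vec (num_nodes G)"
  shows "inner_root G x y =
    (\<Sum>a<m. (\<Sum>i<num_nodes G. x $ i * \<Phi> i a) * (\<Sum>i<num_nodes G. y $ i * \<Phi> i a))"
proof -
  let ?n = "num_nodes G"
  have "inner_root G x y = (\<Sum>i<?n. \<Sum>j<?n. \<Sum>a<m. (x $ i * \<Phi> i a) * (y $ j * \<Phi> j a))"
    using assms unfolding inner_root_sum[OF assms(2,3)]
    by (intro sum.cong refl) (simp add: gram_rep_def sum_distrib_left sum_distrib_right mult_ac)
  also have "\<dots> = (\<Sum>i<?n. \<Sum>a<m. \<Sum>j<?n. (x $ i * \<Phi> i a) * (y $ j * \<Phi> j a))"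
    by (intro sum.cong refl sum.swap)
  also have "\<dots> = (\<Sum>a<m. \<Sum>i<?n. \<Sum>j<?n. (x $ i * \<Phi> i a) * (y $ j * \<Phi> j a))"
    by (rule sum.swap)
  finally show ?thesis by (simp only: sum_product)
qed

text \<open>The quadratic form is a sum of m squares of linear forms; independence of the rows of
  \<Phi> says that they have no common nonzero root.\<close>

lemma pos_def_gram:
  assumes rep: "gram_rep G m \<Phi>"
    and inj: "\<And>x i. (\<And>a. a < m \<Longrightarrow> (\<Sum>i<num_nodes G. x i * \<Phi> i a) = 0) \<Longrightarrow> i < num_nodes G \<Longrightarrow> x i = (0 :: real)"
  shows "pos_def G"
  unfolding pos_def_def
proof (intro ballI impI)
  fix x :: "real vec" assume x: "x \<in> carrier_vec (num_nodes G)" "x \<noteq> 0\<^sub>v (num_nodes G)"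
  let ?\<phi> = "\<lambda>a. \<Sum>i<num_nodes G. x $ i * \<Phi> i a"
  have "\<exists>a<m. ?\<phi> a \<noteq> 0"
  proof (rule ccontr)
    assume "\<not> ?thesis"
    then have "x $ i = 0" if "i < num_nodes G" for i
      using inj[of "\<lambda>i. x $ i"] that by blast
    then have "x = 0\<^sub>v (num_nodes G)" using x(1) by (intro eq_vecI) auto
    then show False using x(2) by simp
  qed
  then obtain a where a: "a < m" "?\<phi> a \<noteq> 0" by blast
  have "0 < ?\<phi> a * ?\<phi> a" using a(2) by (auto simp: zero_less_mult_iff linorder_neq_iff)
  also have "\<dots> \<le> (\<Sum>a<m. ?\<phi> a * ?\<phi> a)"
    using a(1) by (intro member_le_sum[of a "{..<m}" "\<lambda>a. ?\<phi> a * ?\<phi> a"]) auto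
  finally show "0 < inner_root G x x" using inner_root_gram[OF rep x(1,1)] by simp
qed

section \<open>Gram matrices of the signed bases and the diagrams they realize\<close>

context D_coords
begin

lemma D_rows_indep:
  assumes "\<And>a. a < l \<Longrightarrow> (\<Sum>p<l. x p * D p a) = 0" "q < l"
  shows "x q = 0"
proof -
  have "x q = (\<Sum>p<l. if p = q then x p else 0)" using assms(2) by simp
  also have "\<dots> = (\<Sum>p<l. x p * (\<Sum>a<l. D p a * N q a))"
    using assms(2) by (intro sum.cong) (auto simp: D_dual_left)
  also have "\<dots> = (\<Sum>a<l. (\<Sum>p<l. x p * D p a) * N q a)"
    by (simp add: sum_distrib_left sum_distrib_right mult.assoc) (rule sum.swap)
  also have "\<dots> = 0" using assms(1) by simp
  finally show ?thesis .
qed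

lemma gram_chain:
  assumes "p < l - 1" "q < l - 1"
  shows "(\<Sum>j<l. D p j * D q j) =
    \<epsilon> p * \<epsilon> q * (if p = q then 2 else if q = Suc p \<or> p = Suc q then -1 else 0)"
  by (subst sum_D_basis) (use assms in \<open>auto simp: D_basis_def\<close>)

text \<open>The vector e_k + e_(k+1) is orthogonal to e_k - e_(k+1) and meets only the two chain
  neighbours of node \<open>k\<close>, with opposite signs. This closes the four-cycle around
  \<open>k\<close> and accounts for its one dotted edge.\<close>

lemma gram_last:
  assumes "q < l - 1"
  shows "(\<Sum>j<l. D (l - 1) j * D q j) = \<epsilon> (l - 1) * \<epsilon> q * (of_bool (q = Suc k) - of_bool (Suc q = k))"
  by (subst sum_D_basis) (use assms k_less in \<open>auto simp: D_basis_def\<close>)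

lemma gram_last_last: "(\<Sum>j<l. D (l - 1) j * D (l - 1) j) = 2"
  using sign_square[of "l - 1"] k_less by (subst sum_D_basis) (auto simp: D_basis_def algebra_simps)

lemma realizationI:
  assumes "num_nodes \<Gamma> = l" "solid \<Gamma> \<inter> dotted \<Gamma> = {}"
    and chain: "\<And>p q. p < q \<Longrightarrow> q < l - 1 \<Longrightarrow>
      cartan \<Gamma> $$ (p, q) = \<epsilon> p * \<epsilon> q * (if q = Suc p then -1 else 0)"
    and last: "\<And>q. q < l - 1 \<Longrightarrow>
      cartan \<Gamma> $$ (q, l - 1) = \<epsilon> (l - 1) * \<epsilon> q * (of_bool (q = Suc k) - of_bool (Suc q = k))"
  shows "realization l k \<epsilon> \<Gamma>"
proof
  fix p q assume pq: "p < l" "q < l"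
  have gram_sym: "(\<Sum>j<l. D p j * D q j) = (\<Sum>j<l. D q j * D p j)"
    by (simp add: mult.commute)
  consider "p = q" | "p < q" "q < l - 1" | "p < q" "q = l - 1" | "q < p" "p < l - 1" | "q < p" "p = l - 1"
    using pq by linarith
  then show "cartan \<Gamma> $$ (p, q) = (\<Sum>j<l. D p j * D q j)"
  proof cases
    case 1
    show ?thesis
    proof (cases "p = l - 1")
      case True
      then show ?thesis using 1 gram_last_last pq assms(1) by (simp add: cartan_diag)
    next
      case False
      then show ?thesis using 1 gram_chain[of p q] pq assms(1) sign_square[of q]
        by (simp add: cartan_diag)
    qed
  next
    case 2
    then show ?thesis using chain gram_chain[of p q] by simp
  next
    case 3
    then show ?thesis using last[of p] gram_last[of p] gram_sym by simp
  next
    case 4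
    then show ?thesis
      using chain[of q p] gram_chain[of q p] gram_sym cartan_sym[of p \<Gamma> q] pq assms(1) by simp
  next
    case 5
    then show ?thesis
      using last[of q] gram_last[of q] cartan_sym[of p \<Gamma> q] pq assms(1) by simp
  qed
qed (use assms in auto)

end

lemma mem_path_edges: "{p, q} \<in> path_edges m \<longleftrightarrow> (q = Suc p \<and> q < m) \<or> (p = Suc q \<and> p < m)"
  by (auto simp: path_edges_def doubleton_eq_iff)

lemma D_coords_ones: "Suc k < l \<Longrightarrow> D_coords l k (\<lambda>_. 1)"
  by unfold_locales auto

lemma cartan_index:
  assumes "p < num_nodes G" "q < num_nodes G" "p \<noteq> q"
  shows "cartan G $$ (p, q) = (if {p, q} \<in> solid G then -1 else if {p, q} \<in> dotted G then 1 else 0)"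
  using assms by (simp add: cartan_def)

text \<open>With \<open>k = l - 2\<close> no chain node follows \<open>k\<close>, so the last basis
  vector meets the chain at k - 1 only: the four-cycle opens into the fork of D_l.\<close>

lemma realization_D:
  assumes l: "3 \<le> l"
  shows "realization l (l - 2) (\<lambda>_. 1) (D_diagram l)"
proof (rule D_coords.realizationI)
  have n: "num_nodes (D_diagram l) = l" and dotted: "dotted (D_diagram l) = {}"
    by (simp_all add: D_diagram_def)
  show "num_nodes (D_diagram l) = l" by (rule n)
  show "D_coords l (l - 2) (\<lambda>_. 1)" using l by (intro D_coords_ones) simp
  show "solid (D_diagram l) \<inter> dotted (D_diagram l) = {}" by (simp add: dotted)
  fix q assume q: "q < l - 1"
  have "{q, l - 1} \<in> solid (D_diagram l) \<longleftrightarrow> Suc q = l - 2"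
    using q l by (auto simp: D_diagram_def mem_path_edges doubleton_eq_iff)
  moreover have "q \<noteq> Suc (l - 2)" using q by arith
  ultimately show "cartan (D_diagram l) $$ (q, l - 1) =
    1 * 1 * (of_bool (q = Suc (l - 2)) - of_bool (Suc q = l - 2))"
    using q l by (simp add: cartan_index n dotted)
  fix p assume pq: "p < q"
  have "{p, q} \<in> solid (D_diagram l) \<longleftrightarrow> q = Suc p"
    using q pq by (auto simp: D_diagram_def mem_path_edges doubleton_eq_iff)
  then show "cartan (D_diagram l) $$ (p, q) = 1 * 1 * (if q = Suc p then -1 else 0)"
    using q pq by (simp add: cartan_index n dotted)
qed

text \<open>Flipping a basis vector exchanges solid and dotted on its edges. With all signs 1 every
  edge is solid except {k+1, l-1}, hence the reversed convention in \<open>upper\<close>.\<close>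

lemma realization_Da_signs:
  assumes k: "1 \<le> k" "k + 2 < l" and e: "e \<in> Da_cycle l k"
    and sign: "\<And>p. \<epsilon> p = 1 \<or> \<epsilon> p = -1"
    and chain: "\<And>p. Suc p < l - 1 \<Longrightarrow> \<epsilon> p * \<epsilon> (Suc p) = (if {p, Suc p} = e then -1 else 1)"
    and lower: "\<epsilon> (l - 1) * \<epsilon> (k - 1) = (if {k - 1, l - 1} = e then -1 else 1)"
    and upper: "\<epsilon> (l - 1) * \<epsilon> (k + 1) = (if {k + 1, l - 1} = e then 1 else -1)"
  shows "realization l k \<epsilon> (Da_diagram l k e)"
proof (rule D_coords.realizationI)
  let ?G = "Da_diagram l k e"
  have n: "num_nodes ?G = l" and dotted: "dotted ?G = {e}"
    by (simp_all add: Da_diagram_def)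
  show "num_nodes ?G = l" by (rule n)
  show "D_coords l k \<epsilon>" using k sign by unfold_locales auto
  show "solid ?G \<inter> dotted ?G = {}" by (simp add: Da_diagram_def)
  fix q assume q: "q < l - 1"
  have edge: "{q, l - 1} \<in> path_edges (l - 1) \<union> Da_cycle l k \<longleftrightarrow> q = k - 1 \<or> q = k + 1"
    using q k by (auto simp: Da_cycle_def mem_path_edges doubleton_eq_iff)
  have car: "cartan ?G $$ (q, l - 1) =
      (if q = k - 1 \<or> q = k + 1 then (if {q, l - 1} = e then 1 else -1) else 0)"
    using q e edge by (auto simp: cartan_index n dotted Da_diagram_def)
  consider "q = k - 1" | "q = k + 1" | "q \<noteq> k - 1" "q \<noteq> k + 1" by blast
  then show "cartan ?G $$ (q, l - 1) = \<epsilon> (l - 1) * \<epsilon> q * (of_bool (q = Suc k) - of_bool (Suc q = k))"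
  proof cases
    case 1
    then show ?thesis unfolding car using lower k by simp
  next
    case 2
    then show ?thesis unfolding car using upper k by simp
  next
    case 3
    then show ?thesis unfolding car using k by auto
  qed
  fix p assume pq: "p < q"
  have edge: "{p, q} \<in> path_edges (l - 1) \<union> Da_cycle l k \<longleftrightarrow> q = Suc p"
    using q pq k by (auto simp: Da_cycle_def mem_path_edges doubleton_eq_iff)
  have "cartan ?G $$ (p, q) = (if q = Suc p then (if {p, q} = e then 1 else -1) else 0)"
    using q pq e edge by (auto simp: cartan_index n dotted Da_diagram_def)
  then show "cartan ?G $$ (p, q) = \<epsilon> p * \<epsilon> q * (if q = Suc p then -1 else 0)"
    using chain[of p] q by simp
qed

text \<open>To move the dotted edge from {k+1, l-1} to \<open>e\<close>, negate a set of nodes whose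
  only edges to the other nodes are these two: k, ..., l-2, or k+1, ..., l-2, or l-1 alone. If
  \<open>e\<close> is already {k+1, l-1}, nothing is negated.\<close>

lemma realization_Da:
  assumes k: "1 \<le> k" "k + 2 < l" and e: "e \<in> Da_cycle l k"
  shows "\<exists>\<epsilon>. realization l k \<epsilon> (Da_diagram l k e)"
proof -
  consider "e = {k - 1, k}" | "e = {k, k + 1}" | "e = {k - 1, l - 1}" | "e = {k + 1, l - 1}"
    using e by (auto simp: Da_cycle_def)
  then show ?thesis
  proof cases
    case 1
    show ?thesis
      by (rule exI[of _ "\<lambda>p. if k \<le> p \<and> p < l - 1 then -1 else 1"], rule realization_Da_signs[OF k e])
        (use k 1 in \<open>auto simp: doubleton_eq_iff\<close>)
  next
    case 2
    show ?thesis
      by (rule exI[of _ "\<lambda>p. if k < p \<and> p < l - 1 then -1 else 1"], rule realization_Da_signs[OF k e])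
        (use k 2 in \<open>auto simp: doubleton_eq_iff\<close>)
  next
    case 3
    show ?thesis
      by (rule exI[of _ "\<lambda>p. if p = l - 1 then -1 else 1"], rule realization_Da_signs[OF k e])
        (use k 3 in \<open>auto simp: doubleton_eq_iff\<close>)
  next
    case 4
    show ?thesis
      by (rule exI[of _ "\<lambda>p. 1"], rule realization_Da_signs[OF k e])
        (use k 4 in \<open>auto simp: doubleton_eq_iff\<close>)
  qed
qed

lemma realization_D_family:
  assumes "4 \<le> l" "\<Gamma> \<in> D_family l"
  shows "\<exists>k \<epsilon>. realization l k \<epsilon> \<Gamma>"
proof -
  consider "\<Gamma> = D_diagram l" | k e where "1 \<le> k" "k \<le> (l - 2) div 2" "e \<in> Da_cycle l k"
    "\<Gamma> = Da_diagram l k e"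
    using assms(2) unfolding D_family_def by blast
  then show ?thesis
  proof cases
    case 1
    have "3 \<le> l" using assms(1) by simp
    from realization_D[OF this] show ?thesis unfolding 1 by blast
  next
    case 2
    have "k + 2 < l" using 2(2) assms(1) by linarith
    from realization_Da[OF 2(1) this 2(3)] show ?thesis unfolding 2(4) by blast
  qed
qed

section \<open>Positive definiteness of types A, D and E\<close>

lemma pos_def_A:
  assumes "1 \<le> n"
  shows "pos_def (A_diagram n)"
proof -
  interpret D_coords "Suc n" 0 "\<lambda>_. 1" using assms by (intro D_coords_ones) simp
  have n: "num_nodes (A_diagram n) = n" by (simp add: A_diagram_def)
  show ?thesis
  proof (rule pos_def_gram[where m = "Suc n" and \<Phi> = D])
    show "gram_rep (A_diagram n) (Suc n) D"
      unfolding gram_rep_def n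
    proof (intro allI impI)
      fix i j assume "i < n" "j < n"
      then show "cartan (A_diagram n) $$ (i, j) = (\<Sum>a<Suc n. D i a * D j a)"
        using gram_chain[of i j] by (auto simp: cartan_def A_diagram_def mem_path_edges)
    qed
    fix x :: "nat \<Rightarrow> real" and i
    assume 0: "\<And>a. a < Suc n \<Longrightarrow> (\<Sum>i<num_nodes (A_diagram n). x i * D i a) = 0"
      and i: "i < num_nodes (A_diagram n)"
    \<comment> \<open>Type A is the chain part of a basis of D_(n+1). Padding \<open>x\<close> with
      0 at the remaining vector e_0 + e_1 makes the row independence of \<open>D\<close>
      applicable.\<close>
    have "(\<Sum>p<Suc n. (if p = n then 0 else x p) * D p a) = 0" if "a < Suc n" for a
    proof -
      have "(\<Sum>p<Suc n. (if p = n then 0 else x p) * D p a) = (\<Sum>p<n. x p * D p a)"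
        by simp
      then show ?thesis using 0[OF that] by (simp add: n)
    qed
    from D_rows_indep[OF this, of i] show "x i = 0" using i by (simp add: n split: if_splits)
  qed
qed

lemma gram_rep_D:
  assumes "3 \<le> n"
  shows "gram_rep (D_diagram n) n (D_basis n (n - 2) (\<lambda>_. 1))"
  using realization.cartan_gram[OF realization_D[OF assms]] realization.nodes[OF realization_D[OF assms]]
  by (simp add: gram_rep_def)

lemma pos_def_D:
  assumes "3 \<le> n"
  shows "pos_def (D_diagram n)"
proof (rule pos_def_gram[OF gram_rep_D[OF assms]])
  interpret realization n "n - 2" "\<lambda>_. 1" "D_diagram n" by (rule realization_D[OF assms])
  fix x :: "nat \<Rightarrow> real" and i
  assume "\<And>a. a < n \<Longrightarrow> (\<Sum>i<num_nodes (D_diagram n). x i * D i a) = 0" "i < num_nodes (D_diagram n)"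
  then show "x i = 0" using D_rows_indep unfolding nodes by blast
qed

text \<open>The vector attached to the chain \<open>e\<^sub>i - e\<^sub>i\<^sub>+\<^sub>1\<close> at the node \<open>2\<close>; its last coordinate brings
  the squared norm up to \<open>2\<close>, which is possible just for \<open>n < 9\<close>.\<close>

definition E_vector :: "nat \<Rightarrow> nat \<Rightarrow> real" where
  "E_vector n a = (if a \<le> 2 then - 2 / 3 else if a < n then 1 / 3 else sqrt (9 - real n) / 3)"

lemma pos_def_E:
  assumes "n \<in> {6, 7, 8}"
  shows "pos_def (E_diagram n)"
proof -
  interpret D_coords n 0 "\<lambda>_. 1" using assms by (intro D_coords_ones) auto
  define \<Phi> where "\<Phi> p a = (if p = n - 1 then E_vector n a else if a < n then D p a else 0)" for p a
  have n: "num_nodes (E_diagram n) = n" by (simp add: E_diagram_def)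
  have n6: "6 \<le> n" "n \<le> 8" using assms by auto
  have chain: "(\<Sum>a<Suc n. \<Phi> p a * \<Phi> q a) = (\<Sum>a<n. D p a * D q a)" if "p < n - 1" "q < n - 1" for p q
    using that by (simp add: \<Phi>_def)
  have last: "(\<Sum>a<Suc n. \<Phi> p a * \<Phi> (n - 1) a) = (if p = 2 then -1 else 0)" if "p < n - 1" for p
  proof -
    have "(\<Sum>a<Suc n. \<Phi> p a * \<Phi> (n - 1) a) = (\<Sum>a<n. D p a * E_vector n a)"
      using that by (simp add: \<Phi>_def)
    also have "\<dots> = E_vector n p - E_vector n (Suc p)" using that by (subst sum_D_basis) auto
    finally show ?thesis using that n6 by (auto simp: E_vector_def)
  qed
  have norm: "(\<Sum>a<Suc n. \<Phi> (n - 1) a * \<Phi> (n - 1) a) = 2"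
    using assms by (auto simp: \<Phi>_def E_vector_def eval_nat_numeral)
  show ?thesis
  proof (rule pos_def_gram[where m = "Suc n" and \<Phi> = \<Phi>])
    show "gram_rep (E_diagram n) (Suc n) \<Phi>"
      unfolding gram_rep_def n
    proof (intro allI impI)
      fix i j assume ij: "i < n" "j < n"
      have sym: "(\<Sum>a<Suc n. \<Phi> i a * \<Phi> j a) = (\<Sum>a<Suc n. \<Phi> j a * \<Phi> i a)"
        by (simp only: mult.commute)
      consider "i < n - 1" "j < n - 1" | "i < n - 1" "j = n - 1" | "i = n - 1" "j < n - 1" | "i = n - 1" "j = n - 1"
        using ij by linarith
      then show "cartan (E_diagram n) $$ (i, j) = (\<Sum>a<Suc n. \<Phi> i a * \<Phi> j a)"
      proof cases
        case 1
        show ?thesis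
          unfolding chain[OF 1] gram_chain[OF 1]
          using 1 by (auto simp: cartan_def E_diagram_def mem_path_edges doubleton_eq_iff)
      next
        case 2
        show ?thesis
          unfolding 2(2) last[OF 2(1)]
          using 2 n6 by (auto simp: cartan_def E_diagram_def mem_path_edges doubleton_eq_iff)
      next
        case 3
        show ?thesis
          unfolding sym unfolding 3(1) last[OF 3(2)]
          using 3 n6 by (auto simp: cartan_def E_diagram_def mem_path_edges doubleton_eq_iff)
      next
        case 4
        show ?thesis
          unfolding 4 norm using n6 by (simp add: cartan_def E_diagram_def)
      qed
    qed
    fix x :: "nat \<Rightarrow> real" and i
    assume 0: "\<And>a. a < Suc n \<Longrightarrow> (\<Sum>i<num_nodes (E_diagram n). x i * \<Phi> i a) = 0"
      and i: "i < num_nodes (E_diagram n)"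
    \<comment> \<open>Coordinate \<open>n\<close> is the extra one: only the vector at node
      \<open>n - 1\<close> has a component there, and it is nonzero because n < 9.\<close>
    have "(\<Sum>p<n. x p * \<Phi> p n) = (\<Sum>p<n. if p = n - 1 then x p * E_vector n n else 0)"
      by (intro sum.cong) (auto simp: \<Phi>_def)
    then have "x (n - 1) * E_vector n n = 0" using 0[of n] n6 by (simp add: n)
    then have last0: "x (n - 1) = 0" using n6 by (simp add: E_vector_def)
    \<comment> \<open>As the last coefficient vanishes, the last row may be exchanged for that of
      \<open>D\<close>, whose rows are known to be independent.\<close>
    have "(\<Sum>p<n. x p * D p a) = 0" if "a < n" for a
    proof -
      have "(\<Sum>p<n. x p * D p a) = (\<Sum>p<n. x p * \<Phi> p a)"
        using that last0 by (intro sum.cong) (auto simp: \<Phi>_def)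
      then show ?thesis using 0[of a] that by (simp add: n)
    qed
    from D_rows_indep[OF this, of i] show "x i = 0" using i by (simp add: n)
  qed
qed

lemma pos_def_connected_ADE: "G \<in> connected_ADE n \<Longrightarrow> pos_def G"
  using pos_def_A pos_def_D pos_def_E by (auto simp: connected_ADE_def split: if_splits)

lemma cartan_D:
  assumes "p < q" "q < m"
  shows "cartan (D_diagram m) $$ (p, q) =
    (if q = m - 1 then (if p = m - 3 then -1 else 0) else if q = Suc p then -1 else 0)"
proof -
  have "{p, q} \<in> solid (D_diagram m) \<longleftrightarrow> (if q = m - 1 then p = m - 3 else q = Suc p)"
    using assms by (auto simp: D_diagram_def mem_path_edges doubleton_eq_iff)
  then show ?thesis using assms by (auto simp: cartan_index D_diagram_def)
qed

lemma cartan_E: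
  assumes "p < q" "q < m" "4 \<le> m"
  shows "cartan (E_diagram m) $$ (p, q) =
    (if q = m - 1 then (if p = 2 then -1 else 0) else if q = Suc p then -1 else 0)"
proof -
  have "{p, q} \<in> solid (E_diagram m) \<longleftrightarrow> (if q = m - 1 then p = 2 else q = Suc p)"
    using assms by (auto simp: E_diagram_def mem_path_edges doubleton_eq_iff)
  then show ?thesis using assms by (auto simp: cartan_index E_diagram_def)
qed

section \<open>Frames of roots\<close>

definition pair_coords :: "nat \<Rightarrow> nat \<Rightarrow> real \<Rightarrow> real \<Rightarrow> nat \<Rightarrow> real" where
  "pair_coords i j s t = (\<lambda>r. if r = i then s else if r = j then t else 0)"

text \<open>An orthonormal frame whose vectors +-x_i +-x_j form a D_l root subsystem of
  \<open>G\<close>; in contrast to a particular basis, this is symmetric under signed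
  permutations.\<close>

definition root_frame :: "diagram \<Rightarrow> nat \<Rightarrow> (nat \<Rightarrow> real vec) \<Rightarrow> bool" where
  "root_frame G l x \<longleftrightarrow> orthonormal G l x \<and>
     (\<forall>i<l. \<forall>j<l. i \<noteq> j \<longrightarrow> (\<forall>s\<in>{1, -1}. \<forall>t\<in>{1, -1}.
        comb (num_nodes G) l (pair_coords i j s t) x \<in> roots G))"

lemma sum_pair_coords:
  assumes "i < l" "j < l" "i \<noteq> j"
  shows "(\<Sum>r<l. pair_coords i j s t r * f r) = s * f i + t * (f j :: real)"
proof -
  have "(\<Sum>r<l. pair_coords i j s t r * f r) =
      (\<Sum>r<l. (if r = i then s * f r else 0) + (if r = j then t * f r else 0))"
    using assms by (intro sum.cong) (auto simp: pair_coords_def)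
  then show ?thesis using assms by (simp add: sum.distrib)
qed

lemma inner_root_smult:
  assumes "x \<in> carrier_vec (num_nodes G)" "y \<in> carrier_vec (num_nodes G)"
  shows "inner_root G (a \<cdot>\<^sub>v x) (b \<cdot>\<^sub>v y) = a * b * inner_root G x y"
    and "inner_root G x (b \<cdot>\<^sub>v y) = b * inner_root G x y"
  using assms by (simp_all add: inner_root_sum sum_distrib_left mult_ac)

text \<open>Odd numbers of sign changes are included. This is how one root later yields half-spin
  vectors of both parities.\<close>

lemma root_frame_signed:
  assumes x: "root_frame G l x" and \<pi>: "\<pi> permutes {..<l}" and s: "\<And>j. s j = 1 \<or> s j = -1"
  shows "root_frame G l (\<lambda>j. s j \<cdot>\<^sub>v x (\<pi> j))"
proof -
  let ?n = "num_nodes G"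
  have less: "\<pi> j < l" if "j < l" for j using permutes_in_image[OF \<pi>, of j] that by simp
  have inj: "\<pi> i = \<pi> j \<longleftrightarrow> i = j" for i j using permutes_inj[OF \<pi>] by (simp add: inj_eq)
  have car: "j < l \<Longrightarrow> x j \<in> carrier_vec ?n" for j
    using x by (simp add: root_frame_def orthonormal_def)
  have sq: "s j * s j = 1" for j using s[of j] by auto
  have "orthonormal G l (\<lambda>j. s j \<cdot>\<^sub>v x (\<pi> j))"
    using x less car sq unfolding root_frame_def orthonormal_def
    by (auto simp: inner_root_smult(1) inj)
  moreover have "comb ?n l (pair_coords i j t u) (\<lambda>j. s j \<cdot>\<^sub>v x (\<pi> j)) \<in> roots G"
    if ij: "i < l" "j < l" "i \<noteq> j" and tu: "t \<in> {1, -1}" "u \<in> {1, -1}" for i j t u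
  proof -
    have "comb ?n l (pair_coords i j t u) (\<lambda>j. s j \<cdot>\<^sub>v x (\<pi> j)) =
        comb ?n l (pair_coords (\<pi> i) (\<pi> j) (t * s i) (u * s j)) x"
    proof (rule eq_vecI)
      fix r assume "r < dim_vec (comb ?n l (pair_coords (\<pi> i) (\<pi> j) (t * s i) (u * s j)) x)"
      then have r: "r < ?n" by (simp add: comb_def)
      have "r < dim_vec (x (\<pi> i))" "r < dim_vec (x (\<pi> j))"
        using car less ij r by (metis carrier_vecD)+
      then show "comb ?n l (pair_coords i j t u) (\<lambda>j. s j \<cdot>\<^sub>v x (\<pi> j)) $ r =
          comb ?n l (pair_coords (\<pi> i) (\<pi> j) (t * s i) (u * s j)) x $ r"
        using r ij less inj by (simp add: comb_def sum_pair_coords)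
    qed (simp add: comb_def)
    moreover have "t * s i \<in> {1, -1}" "u * s j \<in> {1, -1}" using tu s[of i] s[of j] by auto
    ultimately show ?thesis
      using x less[OF ij(1)] less[OF ij(2)] inj[of i j] ij(3) unfolding root_frame_def by metis
  qed
  ultimately show ?thesis unfolding root_frame_def by blast
qed

context D_coords
begin

lemma D_pair_coords:
  "D (l - 1) = pair_coords k (Suc k) (\<epsilon> (l - 1)) (\<epsilon> (l - 1))"
  "p \<noteq> l - 1 \<Longrightarrow> D p = pair_coords p (Suc p) (\<epsilon> p) (- \<epsilon> p)"
  by (auto simp: D_basis_def pair_coords_def)

text \<open>Starting from +-(e_0 - e_1), permutations give all differences; \<open>neg_swap\<close>
  then gives the sums and their negatives.\<close>

lemma closed_pair_coords:
  assumes P: "closed_coords P" and start: "P (D 0)" and l: "3 \<le> l"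
    and ij: "i < l" "j < l" "i \<noteq> j" and st: "s \<in> {1, -1}" "t \<in> {1, -1}"
  shows "P (pair_coords i j s t)"
proof -
  have move: "P (pair_coords i j s t)"
    if mv: "P (pair_coords a b s t)" "a < l" "b < l" "a \<noteq> b" "i < l" "j < l" "i \<noteq> j" for a b i j s t
  proof -
    obtain \<pi> where \<pi>: "\<pi> permutes {..<l}" "\<pi> i = a" "\<pi> j = b"
      using ex_permutes_pair[of i j a b "{..<l}"] mv by auto
    have "pair_coords a b s t \<circ> \<pi> = pair_coords i j s t"
    proof
      fix r
      have "\<pi> r = a \<longleftrightarrow> r = i" "\<pi> r = b \<longleftrightarrow> r = j"
        using \<pi>(2,3) permutes_inj[OF \<pi>(1)] by (auto simp: inj_eq)
      then show "(pair_coords a b s t \<circ> \<pi>) r = pair_coords i j s t r"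
        by (simp add: pair_coords_def)
    qed
    then show ?thesis using closed_permutes[OF P \<pi>(1) mv(1)] by (simp only:)
  qed
  let ?e = "\<epsilon> 0"
  have e: "?e = 1 \<or> ?e = -1" by (rule sign)
  have "P (pair_coords 0 (Suc 0) ?e (- ?e))"
    using start l D_pair_coords(2)[of 0] by (simp add: D_pair_coords(2))
  then have diff: "P (pair_coords a b ?e (- ?e))" if "a < l" "b < l" "a \<noteq> b" for a b
    using move[of 0 "Suc 0" ?e "- ?e" a b] l that by simp
  have plus: "P (pair_coords a b ?e ?e)" if ab: "a < l" "b < l" "a \<noteq> b" for a b
  proof -
    \<comment> \<open>A third index, available since 3 <= l, turns e_a - e_m into e_a + e_b:
      \<open>neg_swap\<close> of \<open>m\<close> and \<open>b\<close> moves the negative entry to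
      \<open>b\<close> and makes it positive.\<close>
    obtain m where m: "m < l" "m \<noteq> a" "m \<noteq> b"
    proof -
      have "card ({..<l} - {a, b}) \<noteq> 0" using l ab by (simp add: card_Diff_subset)
      then show ?thesis using that by (metis Diff_iff card.empty equals0I insertCI lessThan_iff)
    qed
    have "neg_swap m b (pair_coords a m ?e (- ?e)) = pair_coords a b ?e ?e"
      using m ab by (auto simp: neg_swap_def pair_coords_def)
    moreover have "P (neg_swap m b (pair_coords a m ?e (- ?e)))"
      by (rule closed_neg_swap[OF P diff]) (use m ab in auto)
    ultimately show ?thesis by simp
  qed
  have "neg_swap i j (pair_coords i j ?e ?e) = pair_coords i j (- ?e) (- ?e)"
    using ij by (auto simp: neg_swap_def pair_coords_def)
  then have minus: "P (pair_coords i j (- ?e) (- ?e))"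
    using closed_neg_swap[OF P plus[OF ij] ij] by simp
  have "pair_coords j i ?e (- ?e) = pair_coords i j (- ?e) ?e"
    using ij by (auto simp: pair_coords_def)
  then have diff': "P (pair_coords i j (- ?e) ?e)" using diff[of j i] ij by simp
  have "s = ?e \<or> s = - ?e" "t = ?e \<or> t = - ?e" using e st by auto
  then show ?thesis using diff[OF ij] plus[OF ij] minus diff' by auto
qed

text \<open>\<beta> selects simple roots with Gram matrix that of \<open>D\<close>; the roots of
  \<open>G\<close> are stable under their reflections, so \<open>closed_pair_coords\<close> applies
  to the frame they define. The second clause serves to solve for the frame coordinates of a further
  simple root from Cartan entries.\<close>

lemma simple_root_frame:
  assumes l: "3 \<le> l" and \<beta>: "\<And>p. p < l \<Longrightarrow> \<beta> p < num_nodes G"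
    and gram: "\<And>p q. p < l \<Longrightarrow> q < l \<Longrightarrow> cartan G $$ (\<beta> p, \<beta> q) = (\<Sum>j<l. D p j * D q j)"
  obtains x where "root_frame G l x"
    "\<And>g q. g \<in> carrier_vec (num_nodes G) \<Longrightarrow> q < l \<Longrightarrow>
      inner_root G g (unit_vec (num_nodes G) (\<beta> q)) = (\<Sum>j<l. D q j * inner_root G g (x j))"
proof -
  let ?n = "num_nodes G"
  define \<tau> where "\<tau> p = (unit_vec ?n (\<beta> p) :: real vec)" for p
  define x where "x = (\<lambda>j. comb ?n l (\<lambda>p. N p j) \<tau>)"
  have frame: "orthonormal G l x" "q < l \<Longrightarrow> \<tau> q = comb ?n l (D q) x" for q
    unfolding x_def
    by (rule frame_of_basis; simp add: \<tau>_def inner_root_unit \<beta> gram)+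
  have car: "x j \<in> carrier_vec ?n" for j by (simp add: x_def)
  have closed: "closed_coords (\<lambda>c. comb ?n l c x \<in> roots G)"
  proof (rule closed_coordsI)
    fix i c assume i: "i < l" and c: "comb ?n l c x \<in> roots G"
    let ?t = "\<Sum>r<l. D i r * c r"
    have "simple_reflection G (\<beta> i) (comb ?n l c x) =
        comb ?n l c x - inner_root G (comb ?n l c x) (\<tau> i) \<cdot>\<^sub>v \<tau> i"
      by (simp add: simple_reflection_def \<tau>_def)
    also have "\<dots> = comb ?n l c x - ?t \<cdot>\<^sub>v comb ?n l (D i) x"
      unfolding frame(2)[OF i] orthonormal_inner_comb_comb[OF frame(1)] by (simp only: mult.commute)
    also have "\<dots> = comb ?n l (\<lambda>j. c j - ?t * D i j) x"
      by (rule eq_vecI)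
        (simp_all add: comb_def left_diff_distrib sum_subtractf sum_distrib_left mult.assoc)
    finally show "comb ?n l (\<lambda>j. c j - ?t * D i j) x \<in> roots G"
      using roots_reflection[OF c \<beta>[OF i]] by simp
  qed
  have start: "comb ?n l (D 0) x \<in> roots G"
    using frame(2)[of 0] roots_unit[OF \<beta>[of 0]] l by (simp add: \<tau>_def)
  have "root_frame G l x"
    unfolding root_frame_def using frame(1) closed_pair_coords[OF closed start l] by blast
  moreover have "inner_root G g (unit_vec ?n (\<beta> q)) = (\<Sum>j<l. D q j * inner_root G g (x j))"
    if "g \<in> carrier_vec ?n" "q < l" for g q
    using frame(2)[OF that(2)] inner_root_comb_right[OF that(1) car, of l "D q"] by (simp add: \<tau>_def)
  ultimately show ?thesis using that by blast
qed

end

context realization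
begin

text \<open>The converse of \<open>linkage_coords\<close>: expanding \<open>D\<close> in the frame
  produces a \<Gamma>-set of roots. A root \<open>g\<close> in its span would have squared norm
  equal to the sum of the c_j^2, hence below 2.\<close>

lemma frame_linkage:
  assumes x: "root_frame G l x" and g: "g \<in> roots G"
    and c: "\<And>j. j < l \<Longrightarrow> c j = inner_root G g (x j)"
    and short: "(\<Sum>j<l. c j ^ 2) < 2" and nz: "\<exists>j<l. c j \<noteq> 0"
  shows "lab c \<in> partial_linkage G \<Gamma>"
proof -
  let ?n = "num_nodes G"
  define \<tau> where "\<tau> = (\<lambda>p. comb ?n l (D p) x)"
  have orth: "orthonormal G l x" and car: "j < l \<Longrightarrow> x j \<in> carrier_vec ?n" for j
    using x by (auto simp: root_frame_def orthonormal_def)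
  have gram: "inner_root G (\<tau> p) (\<tau> q) = cartan \<Gamma> $$ (p, q)" if "p < l" "q < l" for p q
    using orthonormal_inner_comb_comb[OF orth] cartan_gram[OF that] by (simp add: \<tau>_def)
  have roots: "\<tau> p \<in> roots G" if "p < l" for p
  proof (cases "p = l - 1")
    case True
    then show ?thesis
      using x k_less sign[of p] unfolding root_frame_def \<tau>_def True D_pair_coords(1) by auto
  next
    case False
    then show ?thesis
      using x that sign[of p] unfolding root_frame_def \<tau>_def D_pair_coords(2)[OF False] by auto
  qed
  have tcar: "\<tau> p \<in> carrier_vec ?n" for p by (simp add: \<tau>_def)
  have inj: "inj_on \<tau> {..<l}"
  proof (rule inj_onI)
    fix p q assume pq: "p \<in> {..<l}" "q \<in> {..<l}" "\<tau> p = \<tau> q"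
    show "p = q"
    proof (rule ccontr)
      assume "p \<noteq> q"
      then have "cartan \<Gamma> $$ (p, q) \<noteq> 2" using pq nodes by (simp add: cartan_index)
      then show False using gram[of p q] gram[of p p] pq cartan_diag[of p \<Gamma>] nodes by simp
    qed
  qed
  have comb: "comb ?n l a \<tau> = comb ?n l (\<lambda>j. \<Sum>p<l. a p * D p j) x" for a
    unfolding \<tau>_def by (rule comb_comb)
  have "LinearCombinations.module.lin_indpt class_ring (module_vec TYPE(real) ?n) (\<tau> ` {..<l})"
  proof (rule lin_indpt_family[OF inj tcar])
    fix a p assume a: "comb ?n l a \<tau> = 0\<^sub>v ?n" and p: "p < l"
    have "(\<Sum>p<l. a p * D p j) = 0" if "j < l" for j
    proof -
      have "(\<Sum>p<l. a p * D p j) = inner_root G (0\<^sub>v ?n) (x j)"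
        using orthonormal_inner_comb[OF orth that, of "\<lambda>j. \<Sum>p<l. a p * D p j"] comb[of a] a by simp
      also have "\<dots> = 0" using car[OF that] by (simp add: inner_root_sum)
      finally show ?thesis .
    qed
    then show "a p = 0" using D_rows_indep[OF _ p] by blast
  qed
  moreover have "({i, j} \<in> solid \<Gamma> \<longleftrightarrow> inner_root G (\<tau> i) (\<tau> j) = -1) \<and>
      ({i, j} \<in> dotted \<Gamma> \<longleftrightarrow> inner_root G (\<tau> i) (\<tau> j) = 1) \<and>
      ({i, j} \<notin> solid \<Gamma> \<union> dotted \<Gamma> \<longleftrightarrow> inner_root G (\<tau> i) (\<tau> j) = 0)"
    if "i < l" "j < l" "i \<noteq> j" for i j
    using that disjoint nodes by (auto simp: gram cartan_index)
  ultimately have gs: "gamma_set \<Gamma> G \<tau>"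
    using roots inj unfolding gamma_set_def nodes by blast
  have labels: "linkage_labels \<Gamma> G \<tau> g = lab c"
  proof (rule eq_vecI)
    fix q assume "q < dim_vec (lab c)"
    then have q: "q < l" by (simp add: lab_def)
    have "inner_root G g (\<tau> q) = (\<Sum>j<l. D q j * inner_root G g (x j))"
      unfolding \<tau>_def by (rule inner_root_comb_right[OF roots_carrier[OF g] car])
    then show "linkage_labels \<Gamma> G \<tau> g $ q = lab c $ q"
      using q c by (simp add: linkage_labels_def lab_def nodes)
  qed (simp add: linkage_labels_def lab_def nodes)
  have "g \<notin> LinearCombinations.module.span class_ring (module_vec TYPE(real) ?n) (\<tau> ` {..<l})"
  proof
    assume "g \<in> LinearCombinations.module.span class_ring (module_vec TYPE(real) ?n) (\<tau> ` {..<l})"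
    then obtain b where b: "g = comb ?n l b x"
      using span_family[OF inj tcar] comb by auto
    have "inner_root G g g = (\<Sum>j<l. b j * b j)"
      unfolding b by (rule orthonormal_inner_comb_comb[OF orth])
    also have "\<dots> = (\<Sum>j<l. c j ^ 2)"
      using c orthonormal_inner_comb[OF orth, of _ b] b by (simp add: power2_eq_square)
    finally show False using short roots_norm[OF g] by simp
  qed
  moreover have "lab c \<noteq> 0\<^sub>v l"
  proof
    assume "lab c = 0\<^sub>v l"
    then have "lab c = lab (\<lambda>_. 0)" by (simp add: lab_def zero_vec_def)
    then show False using lab_inj nz by blast
  qed
  ultimately have "lab c \<in> linkages_of_set \<Gamma> G \<tau>"
    using g labels nodes unfolding linkages_of_set_def by force
  then show ?thesis using gs unfolding partial_linkage_def by blast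
qed

lemma frame_linkage_signed:
  assumes x: "root_frame G l x" and g: "g \<in> roots G" and \<pi>: "\<pi> permutes {..<l}"
    and s: "\<And>j. s j = 1 \<or> s j = -1"
    and c: "\<And>j. j < l \<Longrightarrow> c j = s j * inner_root G g (x (\<pi> j))"
    and short: "(\<Sum>j<l. c j ^ 2) < 2" and nz: "\<exists>j<l. c j \<noteq> 0"
  shows "lab c \<in> partial_linkage G \<Gamma>"
proof (rule frame_linkage[OF root_frame_signed[OF x \<pi> s] g _ short nz])
  fix j assume j: "j < l"
  then have "\<pi> j < l" using permutes_in_image[OF \<pi>, of j] by simp
  then show "c j = inner_root G g (s j \<cdot>\<^sub>v x (\<pi> j))"
    using c[OF j] x roots_carrier[OF g]
    by (simp add: inner_root_smult root_frame_def orthonormal_def)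
qed

section \<open>Upper and lower bounds for the partial linkage systems\<close>

lemma partial_linkage_subset:
  assumes "pos_def G"
  shows "partial_linkage G \<Gamma> \<subseteq> units \<union> (if l \<le> 7 then half_spins True \<union> half_spins False else {})"
proof
  fix v assume "v \<in> partial_linkage G \<Gamma>"
  then obtain \<tau> where \<tau>: "gamma_set \<Gamma> G \<tau>" "v \<in> linkages_of_set \<Gamma> G \<tau>"
    by (auto simp: partial_linkage_def)
  obtain g c where "g \<in> roots G" and v: "v = lab c"
    and "\<And>j. j < l \<Longrightarrow> c j = inner_root G g (comb (num_nodes G) l (\<lambda>p. N p j) \<tau>)"
    and c: "(\<Sum>j<l. c j ^ 2) < 2" "\<exists>j<l. c j \<noteq> 0" "\<And>j. j < l \<Longrightarrow> 2 * c j \<in> \<int>"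
      "\<And>i j. i < l \<Longrightarrow> j < l \<Longrightarrow> c i - c j \<in> \<int>"
    by (rule linkage_coords[OF assms \<tau>]) blast
  from short_cases[OF c(3,4,1,2)]
  show "v \<in> units \<union> (if l \<le> 7 then half_spins True \<union> half_spins False else {})"
    unfolding v by auto
qed

text \<open>The map \<open>\<phi>\<close> gives standard coordinates in R^(l+1), integral on roots.
  If the frame vectors are half-odd in coordinate \<open>a\<close>, their entries there have squares
  summing to at least l/4, which exceeds 1 exactly from l = 5 on.\<close>

lemma D_partial_subset_units:
  assumes l: "5 \<le> l"
  shows "partial_linkage (D_diagram (Suc l)) \<Gamma> \<subseteq> units"
proof
  let ?G = "D_diagram (Suc l)" let ?\<Phi> = "D_basis (Suc l) (Suc l - 2) (\<lambda>_. 1)"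
  have n: "num_nodes ?G = Suc l" by (simp add: D_diagram_def)
  have rep: "gram_rep ?G (Suc l) ?\<Phi>" using l by (intro gram_rep_D) simp
  have pd: "pos_def ?G" using l by (intro pos_def_D) simp
  have \<Phi>_Ints: "?\<Phi> i a \<in> \<int>" for i a
    using D_coords.D_Ints[OF D_coords_ones[of "Suc l - 2" "Suc l"]] l by simp
  define \<phi> where "\<phi> x a = (\<Sum>i<Suc l. x $ i * ?\<Phi> i a)" for x :: "real vec" and a
  have inner: "inner_root ?G x y = (\<Sum>a<Suc l. \<phi> x a * \<phi> y a)"
    if "x \<in> carrier_vec (Suc l)" "y \<in> carrier_vec (Suc l)" for x y
    using inner_root_gram[OF rep, of x y] that unfolding n \<phi>_def by blast
  have root_Ints: "\<phi> x a \<in> \<int>" if "x \<in> roots ?G" for x a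
    unfolding \<phi>_def using roots_Ints[OF that] n \<Phi>_Ints by (intro Ints_sum Ints_mult) auto
  fix v assume "v \<in> partial_linkage ?G \<Gamma>"
  then obtain \<tau> where \<tau>: "gamma_set \<Gamma> ?G \<tau>" "v \<in> linkages_of_set \<Gamma> ?G \<tau>"
    by (auto simp: partial_linkage_def)
  define x where "x = (\<lambda>j. comb (Suc l) l (\<lambda>p. N p j) \<tau>)"
  obtain g c where g: "g \<in> roots ?G" and v: "v = lab c"
    and cx: "\<And>j. j < l \<Longrightarrow> c j = inner_root ?G g (comb (num_nodes ?G) l (\<lambda>p. N p j) \<tau>)"
    and c: "(\<Sum>j<l. c j ^ 2) < 2" "\<exists>j<l. c j \<noteq> 0" "\<And>j. j < l \<Longrightarrow> 2 * c j \<in> \<int>"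
      "\<And>i j. i < l \<Longrightarrow> j < l \<Longrightarrow> c i - c j \<in> \<int>"
    by (rule linkage_coords[OF pd \<tau>]) blast
  have troot: "p < l \<Longrightarrow> \<tau> p \<in> roots ?G" for p
    using \<tau>(1) nodes by (simp add: gamma_set_def)
  have tcar: "p < l \<Longrightarrow> \<tau> p \<in> carrier_vec (num_nodes ?G)" for p
    using troot roots_carrier by blast
  have "orthonormal ?G l (\<lambda>j. comb (num_nodes ?G) l (\<lambda>p. N p j) \<tau>)"
    by (rule frame_of_basis(1)) (use tcar gamma_set_gram[OF \<tau>(1)] in auto)
  then have orth: "orthonormal ?G l x" unfolding n x_def .
  have xcar: "x j \<in> carrier_vec (Suc l)" for j by (simp add: x_def)
  have \<phi>x: "\<phi> (x j) a = (\<Sum>p<l. N p j * \<phi> (\<tau> p) a)" for j a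
  proof -
    have "\<phi> (x j) a = (\<Sum>i<Suc l. \<Sum>p<l. N p j * (\<tau> p $ i * ?\<Phi> i a))"
      unfolding \<phi>_def x_def by (intro sum.cong) (auto simp: comb_def sum_distrib_right mult.assoc)
    also have "\<dots> = (\<Sum>p<l. \<Sum>i<Suc l. N p j * (\<tau> p $ i * ?\<Phi> i a))" by (rule sum.swap)
    finally show ?thesis unfolding \<phi>_def by (simp only: sum_distrib_left)
  qed
  have \<phi>x_Ints: "2 * \<phi> (x j) a \<in> \<int>" "\<phi> (x i) a - \<phi> (x j) a \<in> \<int>" for i j a
  proof -
    have "2 * \<phi> (x j) a = (\<Sum>p<l. 2 * N p j * \<phi> (\<tau> p) a)"
      by (simp add: \<phi>x sum_distrib_left mult.assoc)
    also have "\<dots> \<in> \<int>" by (intro Ints_sum Ints_mult[OF N_Ints(1)] root_Ints troot) auto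
    finally show "2 * \<phi> (x j) a \<in> \<int>" .
    have "\<phi> (x i) a - \<phi> (x j) a = (\<Sum>p<l. (N p i - N p j) * \<phi> (\<tau> p) a)"
      by (simp add: \<phi>x sum_subtractf left_diff_distrib)
    also have "\<dots> \<in> \<int>" by (intro Ints_sum Ints_mult[OF N_Ints(2)] root_Ints troot) auto
    finally show "\<phi> (x i) a - \<phi> (x j) a \<in> \<int>" .
  qed
  \<comment> \<open>The frame vector with index 0 suffices, since \<open>short_cases\<close> tests
    integrality at \<open>c 0\<close>.\<close>
  have x0: "\<phi> (x 0) a \<in> \<int>" if a: "a < Suc l" for a
  proof (rule ccontr)
    assume 0: "\<phi> (x 0) a \<notin> \<int>"
    define y where "y i = \<phi> (x i) a" for i
    have "1 / 4 \<le> y i ^ 2" if "i < l" for i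
    proof -
      have "\<phi> (x i) a \<notin> \<int>"
        using Ints_add[OF \<phi>x_Ints(2)[of 0 a i]] 0 by (metis diff_add_cancel)
      then have "1 / 2 \<le> \<bar>y i\<bar>"
        using half_odd_bounds[OF \<phi>x_Ints(1)] unfolding y_def by fastforce
      then have "1 / 2 * (1 / 2) \<le> \<bar>y i\<bar> * \<bar>y i\<bar>" by (intro mult_mono) auto
      then show ?thesis by (simp add: power2_eq_square)
    qed
    then have "(\<Sum>i<l. 1 / 4) \<le> (\<Sum>i<l. y i ^ 2)" by (intro sum_mono) auto
    then have large: "1 < (\<Sum>i<l. y i ^ 2)" using l by simp
    \<comment> \<open>The projection of the standard unit vector e_a onto the span of the frame: its
      coordinate at \<open>a\<close> and its squared norm both equal the sum of the y_i^2, which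
      therefore is at most 1.\<close>
    define w where "w = comb (Suc l) l y x"
    have wcar: "w \<in> carrier_vec (Suc l)" by (simp add: w_def)
    have "\<phi> w a = (\<Sum>r<Suc l. \<Sum>i<l. y i * (x i $ r * ?\<Phi> r a))"
      unfolding \<phi>_def w_def by (intro sum.cong) (auto simp: comb_def sum_distrib_right mult.assoc)
    also have "\<dots> = (\<Sum>i<l. \<Sum>r<Suc l. y i * (x i $ r * ?\<Phi> r a))" by (rule sum.swap)
    also have "\<dots> = (\<Sum>i<l. y i * y i)" unfolding y_def \<phi>_def by (simp only: sum_distrib_left)
    finally have wa: "\<phi> w a = (\<Sum>i<l. y i ^ 2)" by (simp add: power2_eq_square)
    have "\<phi> w a * \<phi> w a \<le> (\<Sum>a<Suc l. \<phi> w a * \<phi> w a)"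
      using a by (intro member_le_sum[of a "{..<Suc l}" "\<lambda>a. \<phi> w a * \<phi> w a"]) auto
    also have "\<dots> = inner_root ?G w w" using inner[OF wcar wcar] by simp
    also have "\<dots> = (\<Sum>i<l. y i * y i)"
      using orthonormal_inner_comb_comb[OF orth, of y y] unfolding n w_def .
    finally have "(\<Sum>i<l. y i ^ 2) * (\<Sum>i<l. y i ^ 2) \<le> (\<Sum>i<l. y i ^ 2) * 1"
      unfolding wa by (simp add: power2_eq_square)
    then show False using large by (simp add: mult_le_cancel_left)
  qed
  have "c 0 = (\<Sum>a<Suc l. \<phi> g a * \<phi> (x 0) a)"
    using cx[of 0] inner[of g "x 0"] roots_carrier[OF g] xcar l unfolding n x_def by simp
  also have "\<dots> \<in> \<int>" using x0 root_Ints[OF g] by (intro Ints_sum Ints_mult) auto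
  finally show "v \<in> units" using short_cases[OF c(3,4,1,2)] v by blast
qed

text \<open>Deleting node 0 from D_(l+1) leaves D_l, shifted by \<open>Suc\<close>. The deleted
  simple root has inner product -1 with node 1 and 0 with the rest, so its frame coordinates are
  those of -e_0.\<close>

lemma units_subset_D_partial:
  assumes l: "4 \<le> l"
  shows "units \<subseteq> partial_linkage (D_diagram (Suc l)) \<Gamma>"
proof -
  let ?G = "D_diagram (Suc l)" let ?e = "unit_vec (Suc l) 0"
  have n: "num_nodes ?G = Suc l" by (simp add: D_diagram_def)
  interpret std: realization l "l - 2" "\<lambda>_. 1" "D_diagram l" using l by (intro realization_D) simp
  have car: "cartan ?G $$ (Suc p, Suc q) = cartan (D_diagram l) $$ (p, q)" if "p < l" "q < l" for p q
  proof -
    have less: "cartan ?G $$ (Suc p, Suc q) = cartan (D_diagram l) $$ (p, q)" if "p < q" "q < l" for p q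
    proof -
      have "Suc q = Suc l - 1 \<longleftrightarrow> q = l - 1" "Suc p = Suc l - 3 \<longleftrightarrow> p = l - 3"
        "Suc q = Suc (Suc p) \<longleftrightarrow> q = Suc p"
        using l by arith+
      moreover have "Suc p < Suc q" "Suc q < Suc l" using that by auto
      ultimately show ?thesis by (simp only: cartan_D that)
    qed
    show ?thesis
    proof (cases p q rule: linorder_cases)
      case equal
      then show ?thesis using that n std.nodes by (simp add: cartan_diag)
    next
      case greater
      then show ?thesis
        using less[OF greater] that n std.nodes cartan_sym[of p "D_diagram l" q]
          cartan_sym[of "Suc p" ?G "Suc q"] by simp
    qed (use less that in simp)
  qed
  obtain x where x: "root_frame ?G l x"
    and coords: "\<And>g q. g \<in> carrier_vec (num_nodes ?G) \<Longrightarrow> q < l \<Longrightarrow>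
      inner_root ?G g (unit_vec (num_nodes ?G) (Suc q)) = (\<Sum>j<l. std.D q j * inner_root ?G g (x j))"
    by (rule std.simple_root_frame[of Suc ?G])
      (use l n car std.cartan_gram in auto)
  have "std.lab (\<lambda>j. inner_root ?G ?e (x j)) = std.lab (\<lambda>j. if j = 0 then - 1 else 0)"
  proof (rule eq_vecI)
    fix q assume "q < dim_vec (std.lab (\<lambda>j. if j = 0 then - 1 else 0))"
    then have q: "q < l" by (simp add: std.lab_def)
    have "std.lab (\<lambda>j. inner_root ?G ?e (x j)) $ q = cartan ?G $$ (0, Suc q)"
      using coords[of ?e q] q inner_root_unit[of 0 ?G "Suc q"] n by (simp add: std.lab_def)
    also have "\<dots> = (if q = 0 then -1 else 0)"
      using q l cartan_D[of 0 "Suc q" "Suc l"] by auto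
    also have "\<dots> = std.lab (\<lambda>j. if j = 0 then - 1 else 0) $ q"
      using q l by (auto simp: std.lab_def std.sum_D_basis)
    finally show "std.lab (\<lambda>j. inner_root ?G ?e (x j)) $ q = std.lab (\<lambda>j. if j = 0 then - 1 else 0) $ q" .
  qed (simp add: std.lab_def)
  from std.lab_inj[OF this] have inner: "inner_root ?G ?e (x j) = (if j = 0 then - 1 else 0)" if "j < l" for j
    using that by simp
  have e: "?e \<in> roots ?G" using roots_unit[of 0 ?G] n by simp
  show ?thesis
  proof
    fix v assume "v \<in> units"
    then obtain i s where iv: "i < l" "s = 1 \<or> s = -1" "v = lab (\<lambda>j. if j = i then s else 0)"
      by (auto simp: units_def)
    have sum: "(\<Sum>j<l. (if j = i then s else 0) ^ 2) = (\<Sum>j<l. if j = i then 1 else 0 :: real)"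
      using iv(2) by (intro sum.cong) auto
    show "v \<in> partial_linkage ?G \<Gamma>"
      unfolding iv(3)
    proof (rule frame_linkage_signed[OF x e])
      \<comment> \<open>The transposition moves the entry -1 from index 0 to \<open>i\<close>, and
        the sign - s there turns it into s.\<close>
      show "Transposition.transpose 0 i permutes {..<l}"
        using iv(1) l by (intro permutes_swap_id) auto
      show "(if j = i then - s else 1) = 1 \<or> (if j = i then - s else 1) = -1" for j
        using iv(2) by auto
      show "(if j = i then s else 0) = (if j = i then - s else 1) *
          inner_root ?G ?e (x (Transposition.transpose 0 i j))" if "j < l" for j
        using that iv(1) l inner by (auto simp: transpose_def)
      show "(\<Sum>j<l. (if j = i then s else 0) ^ 2) < 2" unfolding sum using iv(1) by simp
      show "\<exists>j<l. (if j = i then s else 0) \<noteq> 0" using iv by auto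
    qed
  qed
qed

text \<open>Deleting node 0 from E_(l+1) also leaves D_l, but now the deleted node was attached to
  an end of its fork, which makes its coordinates a half-spin vector.\<close>

lemma half_spins_subset_E_partial:
  assumes l: "4 \<le> l" "l \<le> 7"
  shows "half_spins b \<subseteq> partial_linkage (E_diagram (Suc l)) \<Gamma>"
proof -
  let ?G = "E_diagram (Suc l)" let ?e = "unit_vec (Suc l) 0"
  \<comment> \<open>The path is reversed: the branch node l - 3 of D_l goes to the branch node 2,
    and the fork ends l - 2 and l - 1 go to 1 and \<open>l\<close>.\<close>
  let ?\<beta> = "\<lambda>p. if p = l - 1 then l else l - 1 - p"
  \<comment> \<open>The solution of: inner product -1 with e_(l-2) - e_(l-1), and 0 with e_(l-2) +
    e_(l-1) and the other differences.\<close>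
  let ?c = "\<lambda>j. if j = l - 1 then 1 / 2 else - 1 / 2 :: real"
  have n: "num_nodes ?G = Suc l" by (simp add: E_diagram_def)
  interpret std: realization l "l - 2" "\<lambda>_. 1" "D_diagram l" using l by (intro realization_D) simp
  have car: "cartan ?G $$ (?\<beta> p, ?\<beta> q) = cartan (D_diagram l) $$ (p, q)" if "p < l" "q < l" for p q
  proof -
    have less: "cartan ?G $$ (?\<beta> p, ?\<beta> q) = cartan (D_diagram l) $$ (p, q)" if "p < q" "q < l" for p q
    proof (cases "q = l - 1")
      case True
      have "l - 1 - p = 2 \<longleftrightarrow> p = l - 3" using that True l by arith
      then have "cartan ?G $$ (l - 1 - p, l) = (if p = l - 3 then -1 else 0)"
        using cartan_E[of "l - 1 - p" l "Suc l"] l by simp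
      moreover have "p \<noteq> l - 1" using that by simp
      ultimately show ?thesis using cartan_D[OF that] True by (simp only: if_True if_False simp_thms)
    next
      case False
      then have "cartan ?G $$ (?\<beta> p, ?\<beta> q) = cartan ?G $$ (l - 1 - q, l - 1 - p)"
        using that n cartan_sym[of "l - 1 - p" ?G "l - 1 - q"] by auto
      moreover have "l - 1 - p = Suc (l - 1 - q) \<longleftrightarrow> q = Suc p" "l - 1 - p \<noteq> Suc l - 1"
        "l - 1 - q < l - 1 - p" "l - 1 - p < Suc l" "4 \<le> Suc l"
        using that False l by arith+
      ultimately show ?thesis using cartan_D[OF that] False by (simp only: cartan_E if_False)
    qed
    show ?thesis
    proof (cases p q rule: linorder_cases)
      case equal
      then show ?thesis using that n std.nodes by (simp add: cartan_diag)
    next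
      case greater
      have "?\<beta> p < num_nodes ?G" "?\<beta> q < num_nodes ?G" using n by auto
      from cartan_sym[OF this] show ?thesis
        unfolding less[OF greater that(1)]
        using cartan_sym[of q "D_diagram l" p] that std.nodes by simp
    qed (use less that in simp)
  qed
  have l3: "3 \<le> l" using l by simp
  have \<beta>: "?\<beta> p < num_nodes ?G" if "p < l" for p using that n by auto
  have gram: "cartan ?G $$ (?\<beta> p, ?\<beta> q) = (\<Sum>j<l. std.D p j * std.D q j)" if "p < l" "q < l" for p q
    using car[OF that] std.cartan_gram[OF that] by simp
  obtain x where x: "root_frame ?G l x"
    and coords: "\<And>g q. g \<in> carrier_vec (num_nodes ?G) \<Longrightarrow> q < l \<Longrightarrow>
      inner_root ?G g (unit_vec (num_nodes ?G) (?\<beta> q)) = (\<Sum>j<l. std.D q j * inner_root ?G g (x j))"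
    by (rule std.simple_root_frame[of ?\<beta> ?G, OF l3 \<beta> gram]; assumption?; rule that; assumption)
  have "std.lab (\<lambda>j. inner_root ?G ?e (x j)) = std.lab ?c"
  proof (rule eq_vecI)
    fix q assume "q < dim_vec (std.lab ?c)"
    then have q: "q < l" by (simp add: std.lab_def)
    have "std.lab (\<lambda>j. inner_root ?G ?e (x j)) $ q = (\<Sum>j<l. std.D q j * inner_root ?G ?e (x j))"
      using q by (simp add: std.lab_def)
    also have "\<dots> = inner_root ?G ?e (unit_vec (num_nodes ?G) (?\<beta> q))"
      by (rule coords[symmetric, OF _ q]) (simp add: n)
    also have "\<dots> = cartan ?G $$ (0, ?\<beta> q)"
      using inner_root_unit[OF _ \<beta>[OF q], of 0] unfolding n by blast
    also have "\<dots> = (if q = l - 2 then -1 else 0)"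
      using q l cartan_E[of 0 "?\<beta> q" "Suc l"] by auto
    also have "\<dots> = std.lab ?c $ q"
      using q l by (auto simp: std.lab_def std.sum_D_basis)
    finally show "std.lab (\<lambda>j. inner_root ?G ?e (x j)) $ q = std.lab ?c $ q" .
  qed (simp add: std.lab_def)
  from std.lab_inj[OF this] have inner: "inner_root ?G ?e (x j) = ?c j" if "j < l" for j
    using that by simp
  have e: "?e \<in> roots ?G" using roots_unit[of 0 ?G] n by simp
  show ?thesis
  proof
    fix v assume "v \<in> half_spins b"
    then obtain A where v: "v = spin A" by (auto simp: half_spins_def)
    let ?d = "\<lambda>j. if j \<in> A then - 1 / 2 else 1 / 2 :: real"
    have "(\<Sum>j<l. ?d j ^ 2) = (\<Sum>j<l. 1 / 4)" by (intro sum.cong) (auto simp: power2_eq_square)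
    show "v \<in> partial_linkage ?G \<Gamma>"
      unfolding v spin_def
    proof (rule frame_linkage_signed[OF x e permutes_id])
      \<comment> \<open>Entrywise quotients are the signs carrying one half-spin vector to any
        other, of either parity.\<close>
      show "?d j / ?c j = 1 \<or> ?d j / ?c j = -1" for j by auto
      show "?d j = ?d j / ?c j * inner_root ?G ?e (x (id j))" if "j < l" for j
        using inner[OF that] by auto
      show "(\<Sum>j<l. ?d j ^ 2) < 2"
        using \<open>(\<Sum>j<l. ?d j ^ 2) = (\<Sum>j<l. 1 / 4)\<close> l by simp
      show "\<exists>j<l. ?d j \<noteq> 0" using l by (intro exI[of _ 0]) auto
    qed
  qed
qed

section \<open>The full linkage systems, rank by rank\<close>

abbreviation "all_half_spins \<equiv> half_spins True \<union> half_spins False"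

lemma partial_subset_full:
  assumes "G \<in> connected_ADE (Suc l)"
  shows "partial_linkage G \<Gamma> \<subseteq> full_linkage \<Gamma>"
  using assms by (auto simp: full_linkage_def nodes partial_linkage_def)

lemma full_linkage_subset:
  "full_linkage \<Gamma> \<subseteq> units \<union> (if l \<le> 7 then all_half_spins else {})"
proof -
  have "partial_linkage G \<Gamma> \<subseteq> units \<union> (if l \<le> 7 then all_half_spins else {})"
    if "G \<in> connected_ADE (Suc l)" for G
    by (rule partial_linkage_subset[OF pos_def_connected_ADE[OF that]])
  then show ?thesis unfolding full_linkage_def nodes by (intro UN_least) simp
qed

lemma D_component_subset_full:
  assumes "3 \<le> l"
  shows "D_component \<Gamma> \<subseteq> full_linkage \<Gamma>"
  using partial_subset_full[of "D_diagram (Suc l)"] assms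
  by (simp add: D_component_def nodes connected_ADE_def)

lemma D_component_large:
  assumes "5 \<le> l"
  shows "D_component \<Gamma> = units"
  using D_partial_subset_units units_subset_D_partial assms by (auto simp: D_component_def nodes)

lemma rank_4:
  assumes l: "l = 4"
  shows "full_linkage \<Gamma> = D_component \<Gamma>" "consists_of_orbits \<Gamma> (D_component \<Gamma>) 3 8"
proof -
  \<comment> \<open>With 5 nodes both layouts attach the last node at 2 = 5 - 3, so the half-spin
    vectors found in the E-layout lie in the D-component.\<close>
  have "E_diagram (Suc l) = D_diagram (Suc l)"
    by (simp add: E_diagram_def D_diagram_def l)
  then have "units \<union> all_half_spins \<subseteq> D_component \<Gamma>"
    using half_spins_subset_E_partial[of True] half_spins_subset_E_partial[of False]
      units_subset_D_partial l
    by (simp add: D_component_def nodes)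
  then have eq: "D_component \<Gamma> = units \<union> all_half_spins" "full_linkage \<Gamma> = units \<union> all_half_spins"
    using D_component_subset_full full_linkage_subset l by auto
  then show "full_linkage \<Gamma> = D_component \<Gamma>" "consists_of_orbits \<Gamma> (D_component \<Gamma>) 3 8"
    using consists_all[OF l] by simp_all
qed

lemma rank_large:
  assumes l: "7 < l"
  shows "full_linkage \<Gamma> = D_component \<Gamma>" "consists_of_orbits \<Gamma> (D_component \<Gamma>) 1 (2 * l)"
  using D_component_subset_full full_linkage_subset D_component_large consists_units l by auto

lemma rank_5_6_7:
  assumes l: "l \<in> {5, 6, 7}"
  shows "full_linkage \<Gamma> = D_component \<Gamma> \<union> E_component \<Gamma>"
    "card (D_component \<Gamma>) = 2 * l"
    "consists_of_orbits \<Gamma> (E_component \<Gamma>) 2 (2 ^ (l - 1))"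
    "card (full_linkage \<Gamma>) = 2 * l + 2 ^ l"
proof -
  have l57: "5 \<le> l" "l \<le> 7" using l by auto
  have D: "D_component \<Gamma> = units" using D_component_large l57 by simp
  have E_mem: "E_diagram (Suc l) \<in> connected_ADE (Suc l)" using l by (auto simp: connected_ADE_def)
  have sub: "partial_linkage (E_diagram (Suc l)) \<Gamma> \<subseteq> units \<union> all_half_spins"
    using partial_linkage_subset[OF pos_def_connected_ADE[OF E_mem]] l57 by simp
  have sup: "all_half_spins \<subseteq> partial_linkage (E_diagram (Suc l)) \<Gamma>"
    using half_spins_subset_E_partial l57 by simp
  have disj: "units \<inter> all_half_spins = {}" using units_half_spins_disjoint by blast
  have E: "E_component \<Gamma> = all_half_spins"
    unfolding E_component_def D nodes using sub sup disj by auto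
  have full: "full_linkage \<Gamma> = units \<union> all_half_spins"
  proof
    show "full_linkage \<Gamma> \<subseteq> units \<union> all_half_spins" using full_linkage_subset l57 by simp
    show "units \<union> all_half_spins \<subseteq> full_linkage \<Gamma>"
      using D_component_subset_full D partial_subset_full[OF E_mem] sup l57 by auto
  qed
  show "full_linkage \<Gamma> = D_component \<Gamma> \<union> E_component \<Gamma>" unfolding full D E ..
  show "card (D_component \<Gamma>) = 2 * l" unfolding D by (rule card_units)
  show "consists_of_orbits \<Gamma> (E_component \<Gamma>) 2 (2 ^ (l - 1))"
    unfolding E by (rule consists_half_spins)
  have fin: "finite units" "finite (half_spins b)" for b
    using card_units card_half_spins[of b] l57 by (auto intro: card_ge_0_finite)
  have "card all_half_spins = 2 ^ (l - 1) + 2 ^ (l - 1)"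
    using card_Un_disjoint[OF fin(2,2) half_spins_disjoint] by (simp add: card_half_spins)
  also have "\<dots> = 2 ^ l" using l57 by (cases l) auto
  finally show "card (full_linkage \<Gamma>) = 2 * l + 2 ^ l"
    unfolding full using card_Un_disjoint[OF fin(1) _ disj] fin(2) by (simp add: card_units)
qed

end

theorem theorem5p3:
  shows
    "(\<forall>\<Gamma> \<in> D_family 4.
        full_linkage \<Gamma> = D_component \<Gamma> \<and>
        consists_of_orbits \<Gamma> (D_component \<Gamma>) 3 8) \<and>
     (\<forall>l>7. \<forall>\<Gamma> \<in> D_family l.
        full_linkage \<Gamma> = D_component \<Gamma> \<and>
        consists_of_orbits \<Gamma> (D_component \<Gamma>) 1 (2 * l)) \<and>
     (\<forall>\<Gamma> \<in> D_family 5.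
        full_linkage \<Gamma> = D_component \<Gamma> \<union> E_component \<Gamma> \<and>
        card (D_component \<Gamma>) = 10 \<and>
        consists_of_orbits \<Gamma> (E_component \<Gamma>) 2 16 \<and>
        card (full_linkage \<Gamma>) = 42) \<and>
     (\<forall>\<Gamma> \<in> D_family 6.
        full_linkage \<Gamma> = D_component \<Gamma> \<union> E_component \<Gamma> \<and>
        card (D_component \<Gamma>) = 12 \<and>
        consists_of_orbits \<Gamma> (E_component \<Gamma>) 2 32 \<and>
        card (full_linkage \<Gamma>) = 76) \<and>
     (\<forall>\<Gamma> \<in> D_family 7.
        full_linkage \<Gamma> = D_component \<Gamma> \<union> E_component \<Gamma> \<and>
        card (D_component \<Gamma>) = 14 \<and>
        consists_of_orbits \<Gamma> (E_component \<Gamma>) 2 64 \<and>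
        card (full_linkage \<Gamma>) = 142)"
proof (intro conjI allI impI ballI)
  fix \<Gamma> assume "\<Gamma> \<in> D_family 4"
  then obtain k \<epsilon> where "realization 4 k \<epsilon> \<Gamma>" using realization_D_family[of 4 \<Gamma>] by auto
  then interpret realization 4 k \<epsilon> \<Gamma> .
  show "full_linkage \<Gamma> = D_component \<Gamma>" "consists_of_orbits \<Gamma> (D_component \<Gamma>) 3 8"
    using rank_4 by simp_all
next
  fix l :: nat and \<Gamma> assume l: "7 < l" and "\<Gamma> \<in> D_family l"
  then obtain k \<epsilon> where "realization l k \<epsilon> \<Gamma>" using realization_D_family[of l \<Gamma>] by auto
  then interpret realization l k \<epsilon> \<Gamma> .
  show "full_linkage \<Gamma> = D_component \<Gamma>" "consists_of_orbits \<Gamma> (D_component \<Gamma>) 1 (2 * l)"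
    using rank_large l by simp_all
next
  fix \<Gamma> assume "\<Gamma> \<in> D_family 5"
  then obtain k \<epsilon> where "realization 5 k \<epsilon> \<Gamma>" using realization_D_family[of 5 \<Gamma>] by auto
  then interpret realization 5 k \<epsilon> \<Gamma> .
  show "full_linkage \<Gamma> = D_component \<Gamma> \<union> E_component \<Gamma>" "card (D_component \<Gamma>) = 10"
    "consists_of_orbits \<Gamma> (E_component \<Gamma>) 2 16" "card (full_linkage \<Gamma>) = 42"
    using rank_5_6_7 by simp_all
next
  fix \<Gamma> assume "\<Gamma> \<in> D_family 6"
  then obtain k \<epsilon> where "realization 6 k \<epsilon> \<Gamma>" using realization_D_family[of 6 \<Gamma>] by auto
  then interpret realization 6 k \<epsilon> \<Gamma> .
  show "full_linkage \<Gamma> = D_component \<Gamma> \<union> E_component \<Gamma>" "card (D_component \<Gamma>) = 12"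
    "consists_of_orbits \<Gamma> (E_component \<Gamma>) 2 32" "card (full_linkage \<Gamma>) = 76"
    using rank_5_6_7 by simp_all
next
  fix \<Gamma> assume "\<Gamma> \<in> D_family 7"
  then obtain k \<epsilon> where "realization 7 k \<epsilon> \<Gamma>" using realization_D_family[of 7 \<Gamma>] by auto
  then interpret realization 7 k \<epsilon> \<Gamma> .
  show "full_linkage \<Gamma> = D_component \<Gamma> \<union> E_component \<Gamma>" "card (D_component \<Gamma>) = 14"
    "consists_of_orbits \<Gamma> (E_component \<Gamma>) 2 64" "card (full_linkage \<Gamma>) = 142"
    using rank_5_6_7 by simp_all
qed

end
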